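(* Let $0<\alpha<2$ and consider three equal masses $m>0$ in the plane with potential $U(x)=\sum_{0\le i<j\le 2} m^2|x_i-x_j|^{-\alpha}$. Then there exists a $2\pi$-periodic choreography $x_i(t)=\gamma\big(t+\tfrac{2\pi i}{3}\big)$, $i=0,1,2$, with generating loop $\gamma$ in the symmetric class $\mathcal H_{\mathrm{eight}}$, which is collision-free, has a node at the origin at the times $t\equiv 0\ (\mathrm{mod}\ \pi)$ (that is, $\gamma(t)=(0,0)$ at these times, so that the origin is a self-intersection point of the loop), and which, after a suitable time reparametrization, solves Newton's equation $$m\,\frac{d^2x_i}{ds^2}=\nabla_{x_i}U(x(s)),\qquad i=0,1,2.$$
   Context: $\mathbb T:=\mathbb R/(2\pi\mathbb Z)$. A loop $\gamma=(x,y)\in H^1(\mathbb T;\mathbb R^2)$ belongs to the symmetric class $\mathcal H_{\mathrm{eight}}$ if $\gamma(0)=(0,0)$ and, for all $t$: (A$_x$) $\gamma(t+\pi)=(x(t),-y(t))$; (Y$^\star$) $\gamma(\tfrac{\pi}{2}+t)=\big(-x(\tfrac{\pi}{2}-t),\,y(\tfrac{\pi}{2}-t)\big)$. The loop $\gamma$ is identified with the three-body choreography $x=(x_0,x_1,x_2)$, $x_i(t)=\gamma(t+2\pi i/3)$. Collision-free means $x_i(t)\neq x_j(t)$ for all $t$ and all $i\ne j$. The time reparametrization meant is a linear one, $s=\sqrt{\rho}\,t$ with a constant $\rho>0$. *)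

theory Defs
  imports "HOL-Analysis.Analysis"
begin

text \<open>
  Functions on \<open>\<real>/(2\<pi>\<int>)\<close> are represented by \<open>2\<pi>\<close>-periodic functions on the reals.
  An element of \<open>H\<^sup>1\<close> is taken to be its continuous representative, that is, the
  primitive of a square-integrable (weak) derivative \<open>g\<close>. Integrability of \<open>g\<close> itself
  on the period follows from square-integrability.
\<close>

definition H1_loops :: "(real \<Rightarrow> real ^ 2) set" where
  "H1_loops = {\<gamma>.
     (\<forall>t. \<gamma> (t + 2 * pi) = \<gamma> t) \<and>
     (\<exists>g. set_borel_measurable lborel {0..2 * pi} g \<and>
          set_integrable lborel {0..2 * pi} (\<lambda>s. (norm (g s))\<^sup>2) \<and>
          (\<forall>t\<in>{0..2 * pi}. \<gamma> t = \<gamma> 0 + (LINT s:{0..t}|lborel. g s)))}"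

definition H_eight :: "(real \<Rightarrow> real ^ 2) set" where
  "H_eight = {\<gamma> \<in> H1_loops.
     \<gamma> 0 = 0 \<and>
     (\<forall>t. \<gamma> (t + pi) = vector [\<gamma> t $ 1, - (\<gamma> t $ 2)]) \<and>
     (\<forall>t. \<gamma> (pi / 2 + t) = vector [- (\<gamma> (pi / 2 - t) $ 1), \<gamma> (pi / 2 - t) $ 2])}"

text \<open>Bodies are numbered 0, 1, 2; values at larger indices are irrelevant below.\<close>

definition choreography :: "(real \<Rightarrow> real ^ 2) \<Rightarrow> nat \<Rightarrow> real \<Rightarrow> real ^ 2" where
  "choreography \<gamma> i t = \<gamma> (t + 2 * pi * real i / 3)"

definition collision_free :: "(nat \<Rightarrow> real \<Rightarrow> real ^ 2) \<Rightarrow> bool" where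
  "collision_free x \<longleftrightarrow> (\<forall>t. \<forall>i\<le>2. \<forall>j\<le>2. i \<noteq> j \<longrightarrow> x i t \<noteq> x j t)"

definition potential :: "real \<Rightarrow> real \<Rightarrow> (nat \<Rightarrow> real ^ 2) \<Rightarrow> real" where
  "potential m \<alpha> q = (\<Sum>j\<le>2. \<Sum>i<j. m\<^sup>2 * norm (q i - q j) powr (- \<alpha>))"

text \<open>
  \<open>v\<close> and \<open>a\<close> are the velocities and accelerations. The gradient with respect to the
  \<open>i\<close>-th position is the gradient of the potential as a function of that position only,
  the other bodies being held fixed.
\<close>

definition solves_newton :: "real \<Rightarrow> real \<Rightarrow> (nat \<Rightarrow> real \<Rightarrow> real ^ 2) \<Rightarrow> bool" where
  "solves_newton m \<alpha> x \<longleftrightarrow> (\<exists>v a. \<forall>i\<le>2. \<forall>s.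
     (x i has_vector_derivative v i s) (at s) \<and>
     (v i has_vector_derivative a i s) (at s) \<and>
     GDERIV (\<lambda>z. potential m \<alpha> ((\<lambda>j. x j s)(i := z))) (x i s) :> m *\<^sub>R a i s)"

end

theory Submission
  imports Defs "HOL-Probability.Hoeffding" "HOL-Probability.Distributions"
    "HOL-Complex_Analysis.Great_Picard"
begin

text \<open>
  Put \<open>D t = \<gamma> t - \<gamma> (t + 2\<pi>/3)\<close> and minimize \<open>\<integral> \<bar>\<gamma>'\<bar>\<^sup>2/2 + \<bar>D\<bar>\<^sup>-\<^sup>\<alpha>\<close> over one period among the symmetric
  \<open>C\<^sup>1\<close> loops without collisions. All mutual distances are translates of \<open>\<bar>D\<bar>\<close>, which is
  \<open>\<pi>\<close>-periodic, and the action is at least \<open>\<integral> \<bar>D'\<bar>\<^sup>2/6 + \<bar>D\<bar>\<^sup>-\<^sup>\<alpha>\<close>. If \<open>D\<close> almost vanishes at \<open>s\<close>, it almost vanishes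
  at \<open>s + \<pi>\<close>, and a Hardy inequality on \<open>[s, s + \<pi>]\<close> whose extremal is the Gaussian isoperimetric
  profile bounds the action from below by
  \<open>2\<pi> c (3\<pi>)\<^sup>-\<^sup>\<beta> (1 - 2\<beta>)\<^sup>-\<^sup>1\<^sup>/\<^sup>2\<close> up to a small error, where \<open>\<beta> = \<alpha>/(\<alpha> + 2)\<close> and \<open>c = inf (r\<^sup>2 + r\<^sup>-\<^sup>\<alpha>)\<close>.
  The Lissajous curve \<open>(A sin 2t, 2\<surd>2 A sin t)\<close> with the best \<open>A\<close> has action
  \<open>2\<pi> c M\<^sup>1\<^sup>-\<^sup>\<beta>\<close>, where \<open>M\<close> is the mean of \<open>(2 + cos u)\<^sup>-\<^sup>\<alpha>\<close>, and Hoeffding's lemma shows that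
  this is smaller for every \<open>\<alpha>\<close> between 0 and 2. Hence minimizing sequences stay away from
  collisions and converge uniformly along a subsequence. The limit \<open>g\<close> satisfies the
  Euler--Lagrange equation tested against symmetric \<open>C\<^sup>2\<close> loops; if \<open>G\<close> is the symmetric loop with
  \<open>G''\<close> equal to the force along \<open>g\<close>, the test loop with second derivative \<open>g - G\<close> gives \<open>g = G\<close>.
\<close>

section \<open>The mean potential of the Lissajous curve\<close>

text \<open>Supplies the limits of \<open>trunc_gauss\<close> needed in
  \<open>hardy_level_tendsto\<close>. The value is read off from the total mass of a normal density;
  dominated convergence removes the truncation.\<close>

lemma integral_gaussian_tendsto:
  fixes c :: real
  assumes "0 < c"
  shows "(\<lambda>n. integral {-real n..real n} (\<lambda>x. exp (- (c * x\<^sup>2)))) \<longlonglongrightarrow> sqrt (pi / c)"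
proof -
  \<comment> \<open>The deviation for which \<open>x\<^sup>2 / (2 * \<sigma>\<^sup>2)\<close> equals
    \<open>c * x\<^sup>2\<close>.\<close>
  define \<sigma> where "\<sigma> = 1 / sqrt (2 * c)"
  have s2: "\<sigma>\<^sup>2 = 1 / (2 * c)" using assms by (simp add: \<sigma>_def power_divide)
  have nd: "normal_density 0 \<sigma> x = sqrt (c / pi) * exp (- (c * x\<^sup>2))" for x
    using assms by (simp add: normal_density_def s2 real_sqrt_divide)
  have s0: "0 < \<sigma>" using assms by (simp add: \<sigma>_def)
  have cp: "sqrt (c / pi) \<noteq> 0" using assms by simp
  have eq: "exp (- (c * x\<^sup>2)) = sqrt (pi / c) * normal_density 0 \<sigma> x" for x
    using assms by (simp add: nd real_sqrt_divide)
  have int: "integrable lborel (\<lambda>x. exp (- (c * x\<^sup>2)))"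
    unfolding eq using s0 by simp
  have val: "(LINT x|lborel. exp (- (c * x\<^sup>2))) = sqrt (pi / c)"
    unfolding eq using s0 by simp
  have "(\<lambda>n. LINT x|lborel. indicator {-real n..real n} x *\<^sub>R exp (- (c * x\<^sup>2)))
      \<longlonglongrightarrow> (LINT x|lborel. exp (- (c * x\<^sup>2)))"
  proof (rule integral_dominated_convergence[where w = "\<lambda>x. exp (- (c * x\<^sup>2))"])
    show "AE x in lborel. (\<lambda>n. indicator {-real n..real n} x *\<^sub>R exp (- (c * x\<^sup>2)))
        \<longlonglongrightarrow> exp (- (c * x\<^sup>2))"
    proof (rule AE_I2)
      fix x :: real
      obtain N :: nat where N: "\<bar>x\<bar> < real N" using reals_Archimedean2 by blast
      have "\<forall>\<^sub>F n in sequentially. indicator {-real n..real n} x *\<^sub>R exp (- (c * x\<^sup>2)) = exp (- (c * x\<^sup>2))"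
        using eventually_ge_at_top[of N]
        by eventually_elim (use N in \<open>auto simp: indicator_def\<close>)
      then show "(\<lambda>n. indicator {-real n..real n} x *\<^sub>R exp (- (c * x\<^sup>2))) \<longlonglongrightarrow> exp (- (c * x\<^sup>2))"
        by (rule tendsto_eventually)
    qed
  qed (auto simp: int indicator_def)
  moreover have "(LINT x|lborel. indicator {-real n..real n} x *\<^sub>R exp (- (c * x\<^sup>2)))
      = integral {-real n..real n} (\<lambda>x. exp (- (c * x\<^sup>2)))" for n
  proof -
    have "set_integrable lborel {-real n..real n} (\<lambda>x. exp (- (c * x\<^sup>2)))"
      by (intro borel_integrable_atLeastAtMost' continuous_intros)
    from set_borel_integral_eq_integral(2)[OF this] show ?thesis
      by (simp add: set_lebesgue_integral_def)
  qed
  ultimately show ?thesis by (simp add: val)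
qed

section \<open>Numerical bounds for pi, logarithms and cosine moments\<close>

lemma pi_less_315: "pi < 3.15"
proof (rule ccontr)
  assume "\<not> ?thesis"
  then have p: "3.15 \<le> pi" by simp
  \<comment> \<open>As 0.525 = 3.15/6, a larger \<open>pi\<close> would force sin 0.525 to be at
    most 1/2, which the Taylor bound of order five refutes.\<close>
  have "sin (0.525::real) \<le> sin (pi / 6)"
    using p pi_less_4 by (intro sin_monotone_2pi_le) auto
  then have "sin (0.525::real) \<le> 1/2" by (simp add: sin_30)
  moreover have "1/2 < sin (0.525::real)"
  proof -
    have A: "\<bar>sin (0.525::real) - (\<Sum>m<5. sin_coeff m * 0.525 ^ m)\<bar> \<le> inverse (fact 5) * \<bar>0.525\<bar> ^ 5"
      by (rule Maclaurin_sin_bound)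
    have "{..<5} = {0, 1, 2, 3, 4::nat}" by auto
    moreover have "sin_coeff 3 = - 1/6" "sin_coeff 4 = 0" "sin_coeff 2 = 0" "sin_coeff (Suc 0) = 1"
      by (simp_all add: sin_coeff_def fact_numeral)
    ultimately have "(\<Sum>m<5. sin_coeff m * (0.525::real) ^ m) = 0.525 - 0.525 ^ 3 / 6"
      by simp
    with A have "0.525 - 0.525 ^ 3 / 6 - inverse (fact 5) * \<bar>0.525\<bar> ^ 5 \<le> sin (0.525::real)"
      by linarith
    then show ?thesis by (simp add: fact_numeral power_divide)
  qed
  ultimately show False by (simp add: eval_nat_numeral)
qed

text \<open>Settles the terms free of \<beta> in \<open>mean_potential_powr_less\<close>; 0.14 is
  twice the loss 0.07 of \<open>integral_ln_two_plus_cos_ge\<close>. With pi < 3.15 the margin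
  between 3 pi/4 and exp 0.86 is below 0.001, so the Taylor polynomial is taken at 0.86/28 and
  raised to the 28th power.\<close>

lemma ln_3pi_div_4_less: "ln (3 * pi / 4) + 0.14 < 1"
proof -
  have "(1 + 0.86/28 + (0.86/28)\<^sup>2/2) ^ 28 \<le> (exp (0.86/28 :: real)) ^ 28"
    by (intro power_mono exp_lower_Taylor_quadratic) auto
  also have "\<dots> = exp 0.86" by (simp flip: exp_of_nat_mult)
  finally have "3 * 3.15 / 4 \<le> exp (0.86::real)" by (simp add: eval_nat_numeral)
  then have "3 * pi / 4 < exp 0.86" using pi_less_315 by simp
  then have "ln (3 * pi / 4) < ln (exp 0.86)"
    by (subst ln_less_cancel_iff) auto
  then show ?thesis by simp
qed

lemma ln_3_less: "ln (3::real) < 1.103"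
proof -
  have "(1 + 1.103/16 + (1.103/16)\<^sup>2/2) ^ 16 \<le> (exp (1.103/16 :: real)) ^ 16"
    by (intro power_mono exp_lower_Taylor_quadratic) auto
  also have "\<dots> = exp 1.103" by (simp flip: exp_of_nat_mult)
  finally have "3 < exp (1.103::real)" by (simp add: eval_nat_numeral)
  then show ?thesis by (metis ln_exp ln_less_cancel_iff exp_gt_zero zero_less_numeral)
qed

text \<open>The last Taylor coefficient 1/6 is doubled to 1/3. The derivative of the difference then
  becomes \<open>x^5 * (1 + 2*x) / (1 + x)\<close>, which has the sign of x as long as x is at least
  -1/2, the range of \<open>cos u / 2\<close>.\<close>

lemma ln_one_plus_ge_poly:
  fixes x :: real
  assumes "- 1/2 \<le> x"
  shows "x - x^2/2 + x^3/3 - x^4/4 + x^5/5 - x^6/3 \<le> ln (1 + x)"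
proof -
  define h where "h x = ln (1 + x) - (x - x^2/2 + x^3/3 - x^4/4 + x^5/5 - x^6/3)" for x :: real
  have d: "(h has_real_derivative (x^5 * (1 + 2*x) / (1 + x))) (at x)" if "- 1/2 \<le> x" for x
  proof -
    have "(h has_real_derivative (1 / (1+x) - (1 - x + x^2 - x^3 + x^4 - 2 * x^5))) (at x)"
      unfolding h_def using that by (auto intro!: derivative_eq_intros)
    moreover have "1 / (1+x) - (1 - x + x^2 - x^3 + x^4 - 2 * x^5) = x^5 * (1 + 2*x) / (1 + x)"
      using that by (simp add: field_simps eval_nat_numeral)
    ultimately show ?thesis by simp
  qed
  have h0: "h 0 = 0" by (simp add: h_def)
  have "0 \<le> h x"
  proof (cases "0 \<le> x")
    case True
    have "h 0 \<le> h x"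
    proof (rule DERIV_nonneg_imp_nondecreasing[OF True])
      fix y :: real assume "0 \<le> y" "y \<le> x"
      then show "\<exists>z. (h has_real_derivative z) (at y) \<and> 0 \<le> z"
        using d[of y] by (intro exI[of _ "y^5 * (1 + 2*y) / (1 + y)"]) auto
    qed
    then show ?thesis by (simp add: h0)
  next
    case False
    have "h 0 \<le> h x"
    proof (rule DERIV_nonpos_imp_nonincreasing[of x 0 h])
      show "x \<le> 0" using False by simp
      fix y assume y: "x \<le> y" "y \<le> 0"
      have "y^5 \<le> 0" using y by (simp add: power_le_zero_eq)
      then have "y^5 * (1 + 2*y) / (1 + y) \<le> 0"
        using y assms by (intro divide_nonpos_pos mult_nonpos_nonneg) auto
      then show "\<exists>z. (h has_real_derivative z) (at y) \<and> z \<le> 0"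
        using d[of y] y assms by auto
    qed
    then show ?thesis by (simp add: h0)
  qed
  then show ?thesis by (simp add: h_def)
qed

text \<open>The function \<open>sin u * cos u ^ (k+1)\<close> vanishes at both ends, and its
  derivative is the combination of the two powers.\<close>

lemma integral_cos_power:
  fixes k :: nat
  shows "integral {0..2*pi} (\<lambda>u. cos u ^ (k+2)) = (k+1)/(k+2) * integral {0..2*pi} (\<lambda>u. cos u ^ k)"
proof -
  have "((\<lambda>u. (k+2) * cos u ^ (k+2) - (k+1) * cos u ^ k) has_integral
      (sin (2*pi) * cos (2*pi) ^ (k+1) - sin 0 * cos 0 ^ (k+1))) {0..2*pi}"
  proof (rule fundamental_theorem_of_calculus)
    fix u :: real
    have "((\<lambda>u. sin u * cos u ^ (k+1)) has_real_derivative
        (k+2) * cos u ^ (k+2) - (k+1) * cos u ^ k) (at u within {0..2*pi})"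
    proof -
      have e: "sin u * (sin u * z) = z - cos u * (cos u * z)" for z
      proof -
        have "sin u * (sin u * z) = (sin u)\<^sup>2 * z" by (simp add: power2_eq_square)
        also have "\<dots> = z - cos u * (cos u * z)"
          by (simp only: sin_squared_eq) (simp add: algebra_simps power2_eq_square)
        finally show ?thesis .
      qed
      show ?thesis
        by (rule derivative_eq_intros refl)+ (simp add: e algebra_simps)
    qed
    then show "((\<lambda>u. sin u * cos u ^ (k+1)) has_vector_derivative
        (k+2) * cos u ^ (k+2) - (k+1) * cos u ^ k) (at u within {0..2*pi})"
      by (simp add: has_real_derivative_iff_has_vector_derivative)
  qed simp
  then have "integral {0..2*pi} (\<lambda>u. (k+2) * cos u ^ (k+2) - (k+1) * cos u ^ k) = 0"
    by (simp add: integral_unique)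
  moreover have "(\<lambda>u. cos u ^ j) integrable_on {0..2*pi}" for j
    by (intro integrable_continuous_real continuous_intros)
  ultimately have "(k+2) * integral {0..2*pi} (\<lambda>u. cos u ^ (k+2)) - (k+1) * integral {0..2*pi} (\<lambda>u. cos u ^ k) = 0"
    by (subst (asm) Henstock_Kurzweil_Integration.integral_diff) (auto intro!: integrable_continuous_real continuous_intros)
  then show ?thesis by (simp add: field_simps)
qed

definition mean_potential :: "real \<Rightarrow> real" where
  "mean_potential \<alpha> = integral {0..2*pi} (\<lambda>u. (2 + cos u) powr (- \<alpha>)) / (2*pi)"

lemma two_plus_cos_bounds: "1 \<le> 2 + cos u" "2 + cos u \<le> 3" "0 < 2 + cos u" for u :: real
  using cos_ge_minus_one[of u] cos_le_one[of u] by linarith+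

text \<open>Apply \<open>ln_one_plus_ge_poly\<close> to \<open>cos u / 2\<close>. Odd moments of the
  cosine vanish and the even ones cost 1/16 + 3/512 + 5/3072, just under 0.07.\<close>

lemma integral_ln_two_plus_cos_ge:
  "2*pi * (ln 2 - 0.07) \<le> integral {0..2*pi} (\<lambda>u. ln (2 + cos u))"
proof -
  define p :: "real \<Rightarrow> real" where "p u = ln 2 + (1/2) * cos u ^ 1 - (1/8) * cos u ^ 2 + (1/24) * cos u ^ 3 - (1/64) * cos u ^ 4
      + (1/160) * cos u ^ 5 - (1/192) * cos u ^ 6" for u
  have le: "p u \<le> ln (2 + cos u)" for u
  proof -
    have "ln (2 + cos u) = ln (2 * (1 + cos u / 2))" by simp
    also have "\<dots> = ln 2 + ln (1 + cos u / 2)"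
      using two_plus_cos_bounds[of u] by (subst ln_mult_pos) auto
    finally show ?thesis
      using ln_one_plus_ge_poly[of "cos u / 2"] cos_ge_minus_one[of u]
      by (simp add: p_def power_divide)
  qed
  define C where "C k = integral {0..2*pi} (\<lambda>u. cos u ^ k)" for k :: nat
  have ci: "((\<lambda>u. cos u ^ k) has_integral C k) {0..2*pi}" for k
    unfolding C_def by (intro integrable_integral integrable_continuous_real continuous_intros)
  have "((\<lambda>u. cos u) has_integral (sin (2*pi) - sin 0)) {0..2*pi}"
    by (rule fundamental_theorem_of_calculus)
      (auto simp flip: has_real_derivative_iff_has_vector_derivative intro!: derivative_eq_intros)
  then have C1: "C 1 = 0" by (simp add: C_def integral_unique)
  have C0: "C 0 = 2 * pi" by (simp add: C_def)
  have Cr: "C (k+2) = (k+1)/(k+2) * C k" for k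
    using integral_cos_power[of k] by (simp add: C_def add.commute)
  have CC: "C 2 = pi" "C 3 = 0" "C 4 = 3/4*pi" "C 5 = 0" "C 6 = 5/8*pi"
    using Cr[of 0] Cr[of 1] Cr[of 2] Cr[of 3] Cr[of 4] C0 C1 by (simp_all add: eval_nat_numeral)
  have c: "((\<lambda>u. ln (2::real)) has_integral (ln 2 * (2*pi))) {0..2*pi}"
    using has_integral_const_real[of "ln (2::real)" 0 "2*pi"] by (simp add: mult.commute)
  have "(p has_integral (ln 2 * (2*pi) + (1/2) * C 1 - (1/8) * C 2 + (1/24) * C 3 - (1/64) * C 4
      + (1/160) * C 5 - (1/192) * C 6)) {0..2*pi}"
    unfolding p_def
    by (intro has_integral_add has_integral_diff has_integral_mult_right ci c)
  moreover have "((\<lambda>u. ln (2 + cos u)) has_integral integral {0..2*pi} (\<lambda>u. ln (2 + cos u))) {0..2*pi}"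
    using two_plus_cos_bounds(3)
    by (intro integrable_integral integrable_continuous_real continuous_intros) (metis less_irrefl)
  ultimately have "ln 2 * (2*pi) + (1/2) * C 1 - (1/8) * C 2 + (1/24) * C 3 - (1/64) * C 4
      + (1/160) * C 5 - (1/192) * C 6 \<le> integral {0..2*pi} (\<lambda>u. ln (2 + cos u))"
    by (rule has_integral_le) (rule le)
  moreover have "2*pi * (ln 2 - 0.07) \<le> ln 2 * (2*pi) + (1/2) * C 1 - (1/8) * C 2 + (1/24) * C 3 - (1/64) * C 4
      + (1/160) * C 5 - (1/192) * C 6"
    unfolding C1 CC using pi_gt_zero by (simp add: algebra_simps)
  ultimately show ?thesis by linarith
qed

text \<open>Hoeffding's lemma for \<open>ln (2 + cos u) \<in> [0, ln 3]\<close>. Its mean is \<open>ln (1 + \<surd>3/2) = ln 2 - 0.0693\<dots>\<close>;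
  for small \<open>\<alpha>\<close> little more than the bound \<open>ln 2 - 0.07\<close> could be given away.\<close>

lemma mean_potential_le:
  assumes "0 < \<alpha>"
  shows "0 < mean_potential \<alpha>"
    and "ln (mean_potential \<alpha>) \<le> - (\<alpha> * (ln 2 - 0.07)) + \<alpha>\<^sup>2 * (ln 3)\<^sup>2 / 8"
proof -
  define l m where "l = ln (3::real)" and "m = integral {0..2*pi} (\<lambda>u. ln (2 + cos u)) / (2*pi)"
  define h p where "h = \<alpha> * l" and "p = 1 - m / l"
  have l: "0 < l" by (simp add: l_def)
  have iL: "(\<lambda>u. ln (2 + cos u)) integrable_on {0..2*pi}"
    using two_plus_cos_bounds(3)
    by (intro integrable_continuous_real continuous_intros) (metis less_irrefl)
  have iP: "(\<lambda>u. (2 + cos u) powr (- \<alpha>)) integrable_on {0..2*pi}"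
    using two_plus_cos_bounds(3)
    by (intro integrable_continuous_real continuous_intros) (metis less_irrefl)
  have Lb: "0 \<le> ln (2 + cos u)" "ln (2 + cos u) \<le> l" for u
    using two_plus_cos_bounds[of u] by (simp_all add: l_def)
  have "integral {0..2*pi} (\<lambda>u. ln (2 + cos u)) \<le> integral {0..2*pi} (\<lambda>u. l)"
    by (intro integral_le iL) (auto simp: Lb)
  then have p0: "0 \<le> p" using l by (simp add: p_def m_def field_simps)
  \<comment> \<open>By convexity \<open>exp\<close> lies below its chord over
    \<open>[- h, 0]\<close>; this replaces the variable by one that takes only the two extreme
    values.\<close>
  have chord: "(2 + cos u) powr (- \<alpha>) \<le> 1 - (1 - exp (- h)) / l * ln (2 + cos u)" for u
  proof -
    define s where "s = ln (2 + cos u) / l"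
    have s: "0 \<le> s" "s \<le> 1" using Lb l by (auto simp: s_def)
    have "exp ((1 - s) *\<^sub>R 0 + s *\<^sub>R (- h)) \<le> (1 - s) * exp 0 + s * exp (- h)"
      by (rule convex_onD[OF exp_convex]) (use s in auto)
    moreover have "(2 + cos u) powr (- \<alpha>) = exp (s * (- h))"
      using two_plus_cos_bounds[of u] l by (simp add: powr_def s_def h_def)
    ultimately show ?thesis by (simp add: s_def algebra_simps diff_divide_distrib)
  qed
  have chord_int: "((\<lambda>u. 1 - (1 - exp (- h)) / l * ln (2 + cos u)) has_integral
      (2*pi - (1 - exp (- h)) / l * (2*pi*m))) {0..2*pi}"
  proof (rule has_integral_diff)
    have "((\<lambda>u. ln (2 + cos u)) has_integral (2*pi*m)) {0..2*pi}"
      using integrable_integral[OF iL] by (simp add: m_def)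
    then show "((\<lambda>u. (1 - exp (- h)) / l * ln (2 + cos u)) has_integral ((1 - exp (- h)) / l * (2*pi*m))) {0..2*pi}"
      by (rule has_integral_mult_right)
    show "((\<lambda>u. 1::real) has_integral (2*pi)) {0..2*pi}"
      using has_integral_const_real[of "1::real" 0 "2*pi"] by simp
  qed
  have "integral {0..2*pi} (\<lambda>u. (2 + cos u) powr (- \<alpha>)) \<le> 2*pi - (1 - exp (- h)) / l * (2*pi*m)"
    by (rule has_integral_le[OF integrable_integral[OF iP] chord_int]) (rule chord)
  then have "mean_potential \<alpha> \<le> 1 - (1 - exp (- h)) / l * m"
    by (simp add: mean_potential_def field_simps)
  \<comment> \<open>The second factor is the moment generating function of a variable that is 1 with
    weight \<open>p\<close> and 0 otherwise, the form in which Hoeffding's lemma bounds it by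
    \<open>exp (h * p + h\<^sup>2 / 8)\<close>.\<close>
  also have "\<dots> = exp (- h) * (1 + p * (exp h - 1))"
    using l by (simp add: p_def algebra_simps exp_minus field_simps)
  finally have le: "mean_potential \<alpha> \<le> exp (- h) * (1 + p * (exp h - 1))" .
  have h0: "0 \<le> h" using assms l by (simp add: h_def)
  have pos: "0 < 1 + p * (exp h - 1)"
    using p0 h0 by (intro add_pos_nonneg mult_nonneg_nonneg) auto
  have "integral {0..2*pi} (\<lambda>u. 3 powr (- \<alpha>)) \<le> integral {0..2*pi} (\<lambda>u. (2 + cos u) powr (- \<alpha>))"
    using assms two_plus_cos_bounds by (intro integral_le iP powr_mono2') auto
  moreover have "0 < integral {0..2*pi} (\<lambda>u. (3::real) powr (- \<alpha>))" by simp
  ultimately have "0 < integral {0..2*pi} (\<lambda>u. (2 + cos u) powr (- \<alpha>))" by (rule less_le_trans[rotated])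
  then show M0: "0 < mean_potential \<alpha>" by (simp add: mean_potential_def)
  have "ln (mean_potential \<alpha>) \<le> ln (exp (- h) * (1 + p * (exp h - 1)))"
    using M0 le pos by simp
  also have "\<dots> = - h + ln (1 + p * (exp h - 1))"
    using pos by (simp add: ln_mult_pos)
  also have "\<dots> \<le> - h + (h * p + h\<^sup>2 / 8)"
    using Hoeffdings_lemma_aux[OF h0 p0] by simp
  also have "\<dots> = - (\<alpha> * m) + \<alpha>\<^sup>2 * l\<^sup>2 / 8"
    using l by (simp add: h_def p_def field_simps)
  also have "\<dots> \<le> - (\<alpha> * (ln 2 - 0.07)) + \<alpha>\<^sup>2 * l\<^sup>2 / 8"
  proof -
    have "ln 2 - 0.07 \<le> m" using integral_ln_two_plus_cos_ge by (simp add: m_def field_simps)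
    then show ?thesis using assms by simp
  qed
  finally show "ln (mean_potential \<alpha>) \<le> - (\<alpha> * (ln 2 - 0.07)) + \<alpha>\<^sup>2 * (ln 3)\<^sup>2 / 8"
    by (simp add: l_def)
qed

lemma minus_ln_one_minus_ge:
  fixes x :: real
  assumes "0 \<le> x" "x < 1"
  shows "x + x^2/2 + x^3/3 \<le> - ln (1 - x)"
proof -
  define h where "h x = - ln (1 - x) - (x + x^2/2 + x^3/3)" for x :: real
  have "h 0 \<le> h x"
  proof (rule DERIV_nonneg_imp_nondecreasing[OF assms(1)])
    fix y assume y: "0 \<le> y" "y \<le> x"
    then have y1: "y < 1" using assms by simp
    have "(h has_real_derivative (1 / (1 - y) - (1 + y + y^2))) (at y)"
      unfolding h_def using y1 by (auto intro!: derivative_eq_intros simp: field_simps)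
    moreover have "1 / (1 - y) - (1 + y + y^2) = y^3 / (1 - y)"
      using y1 by (simp add: field_simps eval_nat_numeral)
    ultimately show "\<exists>z. (h has_real_derivative z) (at y) \<and> 0 \<le> z"
      using y y1 by auto
  qed
  then show ?thesis by (simp add: h_def)
qed

text \<open>The gap between the Lissajous action and the limiting collision level, without the
  common factor \<open>2 * pi * kepler_const \<alpha>\<close>. After logarithms and division by
  \<open>\<beta>\<close>, \<open>ln_3pi_div_4_less\<close> compares the constant terms; the
  expansion of \<open>- ln (1 - 2*\<beta>) / 2\<close> to third order supplies the rest.\<close>

lemma mean_potential_powr_less:
  assumes b: "0 < \<beta>" "\<beta> < 1/2" and a: "\<alpha> = 2 * \<beta> / (1 - \<beta>)"
  shows "mean_potential \<alpha> powr (1 - \<beta>) < (1 / (3*pi)) powr \<beta> * (1 / sqrt (1 - 2*\<beta>))"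
proof -
  have a0: "0 < \<alpha>" using b by (simp add: a)
  note M = mean_potential_le[OF a0]
  define k where "k = (ln 3)\<^sup>2 / (2::real)"
  have k: "k \<le> 0.61" "0 \<le> k"
  proof -
    have "(ln 3)\<^sup>2 \<le> (1.103::real)\<^sup>2" using ln_3_less by (intro power_mono) auto
    then show "k \<le> 0.61" by (simp add: k_def power2_eq_square)
  qed (simp add: k_def)
  have "ln (mean_potential \<alpha> powr (1 - \<beta>)) = (1 - \<beta>) * ln (mean_potential \<alpha>)"
    using M(1) by (simp add: ln_powr)
  also have "\<dots> \<le> (1 - \<beta>) * (- (\<alpha> * (ln 2 - 0.07)) + \<alpha>\<^sup>2 * (ln 3)\<^sup>2 / 8)"
    using b M(2) by (intro mult_left_mono) auto
  also have "\<dots> = \<beta> * (0.14 - 2 * ln 2 + k * \<beta> / (1 - \<beta>))"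
  proof -
    define w where "w = \<beta> / (1 - \<beta>)"
    have w: "\<alpha> = 2 * w" "k * \<beta> / (1 - \<beta>) = k * w" by (simp_all add: a w_def)
    have "(1 - \<beta>) * \<alpha> = 2 * \<beta>" using b by (simp add: a)
    moreover have "(1 - \<beta>) * (- (\<alpha> * c) + \<alpha>\<^sup>2 * (ln 3)\<^sup>2 / 8) = ((1 - \<beta>) * \<alpha>) * (- c + \<alpha> * (ln 3)\<^sup>2 / 8)" for c
      by (simp add: algebra_simps power2_eq_square)
    ultimately have "(1 - \<beta>) * (- (\<alpha> * (ln 2 - 0.07)) + \<alpha>\<^sup>2 * (ln 3)\<^sup>2 / 8)
        = 2 * \<beta> * (- (ln 2 - 0.07) + \<alpha> * (ln 3)\<^sup>2 / 8)"
      by metis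
    also have "\<dots> = \<beta> * (0.14 - 2 * ln 2 + k * \<beta> / (1 - \<beta>))"
      by (simp only: w) (simp add: k_def algebra_simps)
    finally show ?thesis .
  qed
  also have "\<dots> < \<beta> * (- ln (3*pi) + 1 + \<beta> + 4/3 * \<beta>\<^sup>2)"
  proof (intro mult_strict_left_mono b)
    have "k * \<beta> / (1 - \<beta>) \<le> \<beta> + 4/3 * \<beta>\<^sup>2"
    proof -
      have "k \<le> (1 + 4/3 * \<beta>) * (1 - \<beta>)"
      proof -
        \<comment> \<open>As \<open>\<beta> < 1/2\<close>, the product is at least
          \<open>1 - \<beta>/3\<close>, hence at least 5/6, while \<open>k\<close> is at most
          0.61.\<close>
        define x where "x = \<beta> * \<beta>"
        have "\<beta> * \<beta> \<le> \<beta> * (1/2)" using b by (intro mult_left_mono) auto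
        then have "x \<le> \<beta> / 2" by (simp add: x_def)
        moreover have "(1 + 4/3 * \<beta>) * (1 - \<beta>) = 1 + \<beta>/3 - 4/3 * x" by (simp add: x_def field_simps)
        moreover have "k \<le> 1 + \<beta>/3 - 4/3 * y" if "y \<le> \<beta> / 2" for y using that k b by (simp add: field_simps)
        ultimately show ?thesis by simp
      qed
      then have "k * \<beta> \<le> (1 + 4/3 * \<beta>) * (1 - \<beta>) * \<beta>" using b by (intro mult_right_mono) auto
      then show ?thesis using b by (simp add: field_simps power2_eq_square)
    qed
    moreover have "ln (3 * pi / 4) = ln (3*pi) - 2 * ln 2"
      using ln_realpow[of 2 2] by (simp add: ln_div)
    ultimately show "0.14 - 2 * ln 2 + k * \<beta> / (1 - \<beta>) < - ln (3*pi) + 1 + \<beta> + 4/3 * \<beta>\<^sup>2"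
      using ln_3pi_div_4_less by linarith
  qed
  also have "\<dots> \<le> - \<beta> * ln (3*pi) - ln (1 - 2*\<beta>) / 2"
    using minus_ln_one_minus_ge[of "2*\<beta>"] b by (simp add: algebra_simps power2_eq_square power3_eq_cube)
  also have "\<dots> = ln ((1 / (3*pi)) powr \<beta> * (1 / sqrt (1 - 2*\<beta>)))"
    using b by (simp add: ln_mult_pos ln_powr ln_div ln_sqrt algebra_simps)
  finally show ?thesis
    using M(1) b by (subst (asm) ln_less_cancel_iff) auto
qed

section \<open>Periodic functions and the symmetry class\<close>

lemma has_vector_derivative_shift_arg:
  assumes "\<And>t. (f has_vector_derivative f' t) (at t)"
  shows "((\<lambda>t. f (t + c)) has_vector_derivative f' (t + c)) (at t)"
proof -
  have "((\<lambda>s. s + c) has_vector_derivative 1) (at t)" by (auto intro!: derivative_eq_intros)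
  from vector_diff_chain_at[OF this assms] show ?thesis by (simp add: o_def)
qed

lemma has_vector_derivative_minus_arg:
  assumes "\<And>t. (f has_vector_derivative f' t) (at t)"
  shows "((\<lambda>t. f (- t)) has_vector_derivative - f' (- t)) (at t)"
proof -
  have "((\<lambda>s. - s) has_vector_derivative - 1) (at t)" by (auto intro!: derivative_eq_intros)
  from vector_diff_chain_at[OF this assms] show ?thesis by (simp add: o_def)
qed

lemma vector_derivative_zero_const:
  assumes "\<And>t. (f has_vector_derivative 0) (at t)"
  shows "f s = f t"
proof -
  obtain c where "\<And>x. x \<in> UNIV \<Longrightarrow> f x = c"
    using has_vector_derivative_zero_constant[OF convex_UNIV, of f] assms by auto
  then show ?thesis by simp
qed

lemma continuous_on_of_derivative:
  assumes "\<And>t. (f has_vector_derivative f' t) (at t)"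
  shows "continuous_on S f"
  using assms by (meson continuous_at_imp_continuous_on has_vector_derivative_continuous)

lemma continuous_on_shift:
  assumes "continuous_on UNIV (f :: real \<Rightarrow> 'a::topological_space)"
  shows "continuous_on S (\<lambda>t. f (t + c))"
  by (rule continuous_on_compose2[OF assms]) (auto intro!: continuous_intros)

definition period :: "real \<Rightarrow> (real \<Rightarrow> 'a) \<Rightarrow> bool" where
  "period p f \<longleftrightarrow> (\<forall>t. f (t + p) = f t)"

lemma period_int:
  assumes "period p f"
  shows "f (t + of_int k * p) = f t"
proof -
  have nat: "f (t + real n * p) = f t" for n t
  proof (induction n)
    case (Suc n)
    have "f (t + real (Suc n) * p) = f ((t + real n * p) + p)" by (simp add: algebra_simps)
    also have "\<dots> = f (t + real n * p)" using assms by (simp add: period_def)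
    finally show ?case by (simp add: Suc)
  qed simp
  show ?thesis
  proof (cases "0 \<le> k")
    case True then show ?thesis using nat[of t "nat k"] by simp
  next
    case False then show ?thesis using nat[of "t + of_int k * p" "nat (-k)"] by simp
  qed
qed

lemma period_reduce:
  assumes "period p f" "0 < p"
  obtains s where "0 \<le> s" "s < p" "f t = f s"
proof
  define s where "s = t + of_int (- \<lfloor>t / p\<rfloor>) * p"
  have "of_int \<lfloor>t / p\<rfloor> * p \<le> t" "t < (of_int \<lfloor>t / p\<rfloor> + 1) * p"
    using assms(2) floor_divide_lower floor_divide_upper by blast+
  then show "0 \<le> s" "s < p" by (auto simp: s_def algebra_simps)
  show "f t = f s" unfolding s_def by (rule period_int[OF assms(1), symmetric])
qed

lemma period_shift:
  assumes "period p f"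
  shows "period p (\<lambda>t. f (t + c))"
  unfolding period_def
proof
  fix t
  have "f (t + p + c) = f ((t + c) + p)" by (simp add: add_ac)
  then show "f (t + p + c) = f (t + c)" using assms by (simp add: period_def)
qed

lemma period_bounded:
  fixes f :: "real \<Rightarrow> 'a::real_normed_vector"
  assumes "continuous_on UNIV f" "period p f" "0 < p"
  obtains B where "\<And>t. norm (f t) \<le> B" "0 < B"
proof -
  have "compact (f ` {0..p})"
    using assms(1) by (intro compact_continuous_image) (auto intro: continuous_on_subset)
  then obtain B where B: "0 < B" "\<And>t. t \<in> {0..p} \<Longrightarrow> norm (f t) \<le> B"
    by (auto dest!: compact_imp_bounded simp: bounded_pos)
  have "norm (f t) \<le> B" for t
  proof -
    obtain s where "0 \<le> s" "s < p" "f t = f s" using period_reduce[OF assms(2,3), of t] by metis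
    then show ?thesis using B(2)[of s] by simp
  qed
  then show thesis using that B(1) by blast
qed

lemma continuous_integrable [intro]:
  fixes f :: "real \<Rightarrow> 'a::banach"
  assumes "continuous_on UNIV f"
  shows "f integrable_on {a..b}"
  by (rule integrable_continuous_real[OF continuous_on_subset[OF assms]]) simp

lemma integral_period_shift:
  fixes f :: "real \<Rightarrow> 'a::euclidean_space"
  assumes f: "continuous_on UNIV f" and p: "period p f" and "0 < p"
  shows "integral {0..p} (\<lambda>t. f (t + c)) = integral {0..p} f"
    and "integral {c..c + p} f = integral {0..p} f"
proof -
  have shift: "integral {a..b} (\<lambda>t. f (t + d)) = integral {a + d..b + d} f" for a b d
    using integral_shift[of a d b f] continuous_on_subset[OF f] by (simp add: o_def)
  \<comment> \<open>Splitting intervals needs ordered endpoints; other shifts are brought to this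
    case by a whole number of periods.\<close>
  have key: "integral {c..c + p} f = integral {0..p} f" if "0 \<le> c" for c
  proof -
    have "integral {0..c} f + integral {c..c + p} f = integral {0..c + p} f"
      using that \<open>0 < p\<close> f by (intro Henstock_Kurzweil_Integration.integral_combine) auto
    moreover have "integral {0..p} f + integral {p..c + p} f = integral {0..c + p} f"
      using that \<open>0 < p\<close> f by (intro Henstock_Kurzweil_Integration.integral_combine) auto
    moreover have "integral {p..c + p} f = integral {0..c} f"
      using shift[of 0 c p] p by (simp add: period_def)
    ultimately show ?thesis by (metis add_left_cancel add.commute)
  qed
  show main: "integral {c..c + p} f = integral {0..p} f"
  proof -
    define d where "d = of_int (- \<lfloor>c / p\<rfloor>) * p"
    have "0 \<le> c + d"
      using floor_divide_lower[OF \<open>0 < p\<close>, of c] by (simp add: d_def)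
    then have "integral {c + d..c + d + p} f = integral {0..p} f" by (rule key)
    moreover have "integral {c..c + p} (\<lambda>t. f (t + d)) = integral {c + d..c + p + d} f" by (rule shift)
    moreover have "f (t + d) = f t" for t unfolding d_def by (rule period_int[OF p])
    ultimately show ?thesis by (simp add: algebra_simps)
  qed
  show "integral {0..p} (\<lambda>t. f (t + c)) = integral {0..p} f"
    using shift[of 0 p c] main by (simp add: add.commute)
qed

lemma period_deriv:
  fixes f :: "real \<Rightarrow> 'a::real_normed_vector"
  assumes "\<And>t. (f has_vector_derivative f' t) (at t)" "period p f"
  shows "period p f'"
  unfolding period_def
proof
  fix t
  have "((\<lambda>s. f (s + p)) has_vector_derivative f' (t + p)) (at t)"
    by (rule has_vector_derivative_shift_arg[OF assms(1)])
  then have "(f has_vector_derivative f' (t + p)) (at t)"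
    using assms(2) by (simp add: period_def)
  then show "f' (t + p) = f' t" using assms(1) vector_derivative_unique_at by blast
qed

section \<open>The reflection and the symmetry class\<close>

definition mirror :: "real ^ 2 \<Rightarrow> real ^ 2" where
  "mirror v = vector [v $ 1, - (v $ 2)]"

lemma mirror_component [simp]: "mirror v $ 1 = v $ 1" "mirror v $ 2 = - (v $ 2)"
  by (simp_all add: mirror_def)

lemma vec2_eqI: "v $ 1 = w $ 1 \<Longrightarrow> v $ 2 = w $ 2 \<Longrightarrow> v = (w :: 'a ^ 2)"
  by (simp add: vec_eq_iff forall_2)

lemma mirror_linear [simp]:
  "mirror 0 = 0" "mirror (v + w) = mirror v + mirror w" "mirror (v - w) = mirror v - mirror w"
  "mirror (- v) = - mirror v" "mirror (c *\<^sub>R v) = c *\<^sub>R mirror v" "mirror (mirror v) = v"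
  by (auto intro!: vec2_eqI)

lemma inner_mirror [simp]: "mirror v \<bullet> mirror w = v \<bullet> w"
  by (simp add: inner_vec_def sum_2)

lemma norm_mirror [simp]: "norm (mirror v) = norm v"
  by (simp add: norm_eq_sqrt_inner)

lemma bounded_linear_mirror: "bounded_linear mirror"
  by (rule bounded_linear_intro[where K = 1]) auto

definition eight_symmetric :: "(real \<Rightarrow> real ^ 2) \<Rightarrow> bool" where
  "eight_symmetric f \<longleftrightarrow> (\<forall>t. f (t + pi) = mirror (f t) \<and> f (- t) = - f t)"

lemma eight_symmetricD:
  assumes "eight_symmetric f"
  shows "f (t + pi) = mirror (f t)" "f (- t) = - f t" "f (t + 2 * pi) = f t" "f 0 = 0"
proof -
  show 1: "f (t + pi) = mirror (f t)" "f (- t) = - f t" for t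
    using assms by (auto simp: eight_symmetric_def)
  show "f (t + 2 * pi) = f t" using 1(1)[of t] 1(1)[of "t + pi"] by (simp add: add.assoc)
  have "f 0 = - f 0" using 1(2)[of 0] by simp
  then have "2 *\<^sub>R f 0 = 0" by (simp add: scaleR_2)
  then show "f 0 = 0" by simp
qed

section \<open>A lower bound for the action of near-collision arcs\<close>

text \<open>An infimum suffices on both sides of the comparison: the lower estimate uses
  \<open>kepler_young\<close>, the competitor an almost minimizing radius.\<close>

definition kepler_const :: "real \<Rightarrow> real" where
  "kepler_const \<alpha> = (INF r\<in>{0<..}. r\<^sup>2 + r powr (- \<alpha>))"

lemma kepler_terms_ge_1:
  fixes r \<alpha> :: real
  assumes "0 < r" "0 < \<alpha>"
  shows "1 \<le> r\<^sup>2 + r powr (- \<alpha>)"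
proof (cases "1 \<le> r")
  case True
  then have "1 \<le> r\<^sup>2" by (simp add: one_le_power)
  then show ?thesis by (simp add: add_increasing2)
next
  case False
  then have "1 powr (- \<alpha>) \<le> r powr (- \<alpha>)" using assms by (intro powr_mono2') auto
  then show ?thesis by (simp add: add_increasing)
qed

lemma kepler_const_bdd:
  fixes \<alpha> :: real
  shows "0 < \<alpha> \<Longrightarrow> bdd_below ((\<lambda>r. r\<^sup>2 + r powr (- \<alpha>)) ` {0<..})"
  by (intro bdd_belowI2[where m = 1]) (auto intro: kepler_terms_ge_1)

lemma kepler_const_ge_1: "0 < \<alpha> \<Longrightarrow> 1 \<le> kepler_const \<alpha>"
  unfolding kepler_const_def by (intro cINF_greatest) (auto intro: kepler_terms_ge_1)

lemma kepler_const_less: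
  assumes "0 < \<alpha>" "kepler_const \<alpha> < b"
  obtains r where "0 < r" "r\<^sup>2 + r powr (- \<alpha>) < b"
  using assms(2) unfolding kepler_const_def
  by (subst (asm) cINF_less_iff) (use kepler_const_bdd[OF assms(1)] in auto)

text \<open>Rescaling the radius by \<open>A powr (1 / (\<alpha> + 2))\<close> gives both terms the
  same power of \<open>A\<close>. This serves twice: for the Hardy weight on an arc and for the best
  amplitude of the Lissajous curve.\<close>

lemma kepler_scaling:
  fixes A r \<alpha> :: real
  assumes "0 < A" "0 < r" "0 < \<alpha>"
  shows "A * r\<^sup>2 + r powr (- \<alpha>) =
    A powr (\<alpha> / (\<alpha> + 2)) * ((r * A powr (1 / (\<alpha> + 2)))\<^sup>2 + (r * A powr (1 / (\<alpha> + 2))) powr (- \<alpha>))"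
proof -
  have "A powr (\<alpha> / (\<alpha> + 2)) * (A powr (1 / (\<alpha> + 2)))\<^sup>2 = A powr (\<alpha> / (\<alpha> + 2) + 2 * (1 / (\<alpha> + 2)))"
    by (simp add: power2_eq_square flip: powr_add)
  also have "\<alpha> / (\<alpha> + 2) + 2 * (1 / (\<alpha> + 2)) = 1"
    using assms by (simp flip: add_divide_distrib)
  finally have 1: "A powr (\<alpha> / (\<alpha> + 2)) * (A powr (1 / (\<alpha> + 2)))\<^sup>2 = A" using assms by simp
  have "A powr (\<alpha> / (\<alpha> + 2)) * (A powr (1 / (\<alpha> + 2))) powr (- \<alpha>) = A powr (\<alpha> / (\<alpha> + 2) + (1 / (\<alpha> + 2)) * (- \<alpha>))"
    by (simp only: powr_powr powr_add)
  also have "\<alpha> / (\<alpha> + 2) + (1 / (\<alpha> + 2)) * (- \<alpha>) = 0" by simp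
  finally have 2: "A powr (\<alpha> / (\<alpha> + 2)) * (A powr (1 / (\<alpha> + 2))) powr (- \<alpha>) = 1" using assms by simp
  show ?thesis using assms 1 2
    by (simp add: powr_mult power_mult_distrib distrib_left mult.left_commute[of _ "r\<^sup>2"]
        mult.left_commute[of _ "r powr _"])
qed

lemma kepler_young:
  assumes "0 < A" "0 < r" "0 < \<alpha>"
  shows "kepler_const \<alpha> * A powr (\<alpha> / (\<alpha> + 2)) \<le> A * r\<^sup>2 + r powr (- \<alpha>)"
proof -
  have "kepler_const \<alpha> \<le> (r * A powr (1 / (\<alpha> + 2)))\<^sup>2 + (r * A powr (1 / (\<alpha> + 2))) powr (- \<alpha>)"
    unfolding kepler_const_def by (rule cINF_lower[OF kepler_const_bdd]) (use assms in auto)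
  then show ?thesis
    unfolding kepler_scaling[OF assms] by (subst mult.commute) (intro mult_left_mono, auto)
qed

section \<open>The Gaussian change of time on an arc\<close>

definition trunc_gauss :: "real \<Rightarrow> real \<Rightarrow> real" where
  "trunc_gauss c X = integral {- X..X} (\<lambda>x. exp (- (c * x\<^sup>2)))"

lemma trunc_gauss_pos:
  assumes "0 < X" shows "0 < trunc_gauss c X"
proof -
  have i: "(\<lambda>x. exp (- (c * x\<^sup>2))) integrable_on {- X..X}"
    by (intro integrable_continuous_real continuous_intros)
  have "integral {- X..X} (\<lambda>x. exp (- (\<bar>c\<bar> * X\<^sup>2))) \<le> trunc_gauss c X"
    unfolding trunc_gauss_def
  proof (intro integral_le i)
    fix x assume "x \<in> {- X..X}"
    then have "x\<^sup>2 \<le> X\<^sup>2" by (intro abs_le_square_iff[THEN iffD1]) auto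
    then have "c * x\<^sup>2 \<le> \<bar>c\<bar> * X\<^sup>2" by (intro mult_mono) auto
    then show "exp (- (\<bar>c\<bar> * X\<^sup>2)) \<le> exp (- (c * x\<^sup>2))" by simp
  qed (rule integrable_const_ivl)
  moreover have "0 < integral {- X..X} (\<lambda>x. exp (- (\<bar>c\<bar> * X\<^sup>2)))" using assms by simp
  ultimately show ?thesis by (rule less_le_trans[rotated])
qed

text \<open>The time parameter is \<open>\<pi>\<close> times the distribution function of a truncated Gaussian variable \<open>x\<close>.
  In terms of \<open>x\<close>, completing the square gives a Hardy inequality with weight
  \<open>(Z/\<pi>)\<^sup>2 exp (x\<^sup>2)\<close>, which is combined with the potential by Young's inequality.\<close>

lemma arc_action_ge:
  fixes D D' :: "real \<Rightarrow> 'a::euclidean_space"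
  assumes D: "\<And>t. (D has_vector_derivative D' t) (at t)" and D': "continuous_on UNIV D'"
    and nz: "\<And>t. D t \<noteq> 0" and per: "norm (D (s + pi)) = norm (D s)"
    and "0 < \<alpha>" "0 < X"
  defines "\<beta> \<equiv> \<alpha> / (\<alpha> + 2)" and "w \<equiv> pi / trunc_gauss (1/2) X"
  shows "kepler_const \<alpha> * ((1/6) powr \<beta> * (1/w) powr (2*\<beta>) * w * trunc_gauss (1/2 - \<beta>) X)
      - X * exp (X\<^sup>2/2) / (3*w) * (norm (D s))\<^sup>2
    \<le> integral {s..s+pi} (\<lambda>t. (norm (D' t))\<^sup>2 / 6 + norm (D t) powr (- \<alpha>))"
proof -
  \<comment> \<open>The time \<open>T\<close> runs from \<open>s\<close> to \<open>s + pi\<close>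
    with speed \<open>w / e x\<close>. \<open>P\<close> is the logarithmic time derivative of the
    Hardy extremal, which in terms of \<open>x\<close> is
    \<open>exp (- x\<^sup>2 / 2)\<close>.\<close>
  define g e T P where "g = (\<lambda>x::real. exp (- ((1/2) * x\<^sup>2)))" and "e = (\<lambda>x::real. exp (x\<^sup>2/2))"
    and "T = (\<lambda>x. s + w * integral {- X..x} g)" and "P = (\<lambda>x. - (x * e x / w))"
  define u where "u t = (norm (D' t))\<^sup>2 / 6 + norm (D t) powr (- \<alpha>)" for t
  have Z: "0 < trunc_gauss (1/2) X" by (rule trunc_gauss_pos) fact
  have w: "0 < w" using Z by (simp add: w_def)
  have ge: "g x = 1 / e x" "0 < e x" for x by (auto simp: g_def e_def exp_minus field_simps)
  have gc: "continuous_on S g" for S unfolding g_def by (intro continuous_intros)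
  have Dc: "continuous_on S D" for S
    using D by (rule continuous_on_of_derivative)
  have uc: "continuous_on UNIV u"
    unfolding u_def by (intro continuous_intros D' Dc) (auto simp: nz)
  have T: "(T has_real_derivative w / e x) (at x within {- X..X})" if "x \<in> {- X..X}" for x
  proof -
    have "((\<lambda>x. integral {- X..x} g) has_vector_derivative g x) (at x within {- X..X})"
      by (rule integral_has_vector_derivative[OF gc that])
    then have "((\<lambda>x. integral {- X..x} g) has_real_derivative g x) (at x within {- X..X})"
      by (simp add: has_real_derivative_iff_has_vector_derivative)
    from DERIV_cmult[OF this, of w] have "((\<lambda>x. s + w * integral {- X..x} g) has_real_derivative 0 + w * g x) (at x within {- X..X})"
      by (intro DERIV_add DERIV_const)
    then show ?thesis by (simp add: T_def ge)
  qed
  have Tm: "T (- X) = s" by (simp add: T_def)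
  have TX: "T X = s + pi" using Z by (simp add: T_def w_def trunc_gauss_def g_def)
  have Tsub: "T ` {- X..X} \<subseteq> {s..s+pi}"
  proof -
    have "T (- X) \<le> T x \<and> T x \<le> T X" if x: "x \<in> {- X..X}" for x
    proof -
      have "integral {- X..x} g + integral {x..X} g = integral {- X..X} g"
        using x by (intro Henstock_Kurzweil_Integration.integral_combine integrable_continuous_real gc) auto
      moreover have "0 \<le> integral {- X..x} g" "0 \<le> integral {x..X} g"
        by (intro integral_nonneg integrable_continuous_real gc; simp add: g_def)+
      ultimately have "w * integral {- X..x} g \<le> w * integral {- X..X} g" "0 \<le> w * integral {- X..x} g"
        using w by auto
      then show ?thesis by (simp add: T_def)
    qed
    then show ?thesis unfolding Tm TX by auto
  qed
  have sub: "((\<lambda>x. w / e x * u (T x)) has_integral integral {s..s+pi} u) {- X..X}"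
    using has_integral_substitution[of "- X" X T s "s + pi" u "\<lambda>x. w / e x"] Tsub T \<open>0 < X\<close>
      continuous_on_subset[OF uc] by (simp add: Tm TX)
  \<comment> \<open>The derivative of \<open>(D (T x) \<bullet> D (T x)) * P x\<close>: subtracting
    it completes the square, and it integrates to boundary terms.\<close>
  define B' where "B' x = 2 * (D (T x) \<bullet> D' (T x)) * (w / e x) * P x
      + (D (T x) \<bullet> D (T x)) * (- ((1 + x\<^sup>2) * e x / w))" for x
  have ed: "(e has_real_derivative x * e x) (at x within S)" for x S
    unfolding e_def by (auto intro!: derivative_eq_intros)
  have Pd: "(P has_real_derivative - ((1 + x\<^sup>2) * e x / w)) (at x within S)" for x S
    unfolding P_def using w by (auto intro!: derivative_eq_intros ed simp: field_simps power2_eq_square)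
  have Bint: "(B' has_integral ((D (T X) \<bullet> D (T X)) * P X - (D (T (- X)) \<bullet> D (T (- X))) * P (- X))) {- X..X}"
  proof (rule fundamental_theorem_of_calculus)
    fix x assume x: "x \<in> {- X..X}"
    have DT: "((D \<circ> T) has_vector_derivative (w / e x) *\<^sub>R D' (T x)) (at x within {- X..X})"
    proof (rule vector_diff_chain_within)
      show "(T has_vector_derivative w / e x) (at x within {- X..X})"
        using T[OF x] by (simp add: has_real_derivative_iff_has_vector_derivative)
    qed (rule has_vector_derivative_at_within[OF D])
    have "((\<lambda>x. (D \<circ> T) x \<bullet> (D \<circ> T) x) has_real_derivative
        2 * (D (T x) \<bullet> D' (T x)) * (w / e x)) (at x within {- X..X})"
      using bounded_bilinear.has_vector_derivative[OF bounded_bilinear_inner DT DT]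
      by (simp add: has_real_derivative_iff_has_vector_derivative inner_commute algebra_simps)
    from DERIV_mult[OF this Pd]
    show "((\<lambda>x. (D (T x) \<bullet> D (T x)) * P x) has_vector_derivative B' x) (at x within {- X..X})"
      by (simp add: has_real_derivative_iff_has_vector_derivative[symmetric] B'_def algebra_simps)
  qed (use \<open>0 < X\<close> in simp)
  have pt: "B' x / 6 + kepler_const \<alpha> * ((1/6) powr \<beta> * (1/w) powr (2*\<beta>) * w) * exp (- ((1/2 - \<beta>) * x\<^sup>2))
      \<le> w / e x * u (T x)" for x
  proof -
    define r where "r = norm (D (T x))"
    \<comment> \<open>Chosen so that \<open>w / e x * (A * r\<^sup>2)\<close> is one sixth of the
      term \<open>r\<^sup>2 * (e x / w)\<close> that the square leaves over.\<close>
    define A where "A = (e x / w)\<^sup>2 / 6"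
    have r: "0 < r" using nz by (simp add: r_def)
    have A: "0 < A" using ge(2)[of x] w by (simp add: A_def)
    \<comment> \<open>The square absorbs the \<open>x\<^sup>2\<close> part of the derivative of
      \<open>P\<close>; the other part remains as the Hardy weight.\<close>
    have sq: "w / e x * (norm (D' (T x)))\<^sup>2 - B' x
        = w / e x * (norm (D' (T x) + (x * e x / w) *\<^sub>R D (T x)))\<^sup>2 + r\<^sup>2 * (e x / w)"
      using ge(2)[of x] w unfolding r_def power2_norm_eq_inner B'_def P_def
      by (simp add: inner_add_left inner_add_right inner_commute field_simps power2_eq_square)
    have h1: "r\<^sup>2 * (e x / w) \<le> w / e x * (norm (D' (T x)))\<^sup>2 - B' x"
      unfolding sq using w ge(2)[of x] by simp
    have h2: "w / e x * (A * r\<^sup>2) = r\<^sup>2 * (e x / w) / 6"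
      using w ge(2)[of x] by (simp add: A_def field_simps power2_eq_square)
    have h3: "w / e x * (kepler_const \<alpha> * A powr \<beta>) \<le> w / e x * (A * r\<^sup>2 + r powr (- \<alpha>))"
      unfolding \<beta>_def using w ge(2)[of x] A r \<open>0 < \<alpha>\<close> by (intro mult_left_mono kepler_young) auto
    \<comment> \<open>The powers of \<open>e x\<close> combine to the exponent
      \<open>2 * \<beta> - 1\<close>, again a Gaussian. It is integrable over the whole line exactly
      when \<open>\<beta> < 1/2\<close>, that is \<open>\<alpha> < 2\<close>.\<close>
    have pw: "w / e x * A powr \<beta> = (1/6) powr \<beta> * (1/w) powr (2*\<beta>) * w * exp (- ((1/2 - \<beta>) * x\<^sup>2))"
    proof -
      have "A powr \<beta> = (1/6) powr \<beta> * ((1/w) powr 2) powr \<beta> * ((e x) powr 2) powr \<beta>"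
        using w ge(2)[of x] by (simp add: A_def powr_mult powr_divide field_simps power_divide)
      also have "\<dots> = (1/6) powr \<beta> * (1/w) powr (2*\<beta>) * (e x) powr (2*\<beta>)"
        by (simp only: powr_powr)
      also have "(e x) powr (2*\<beta>) = e x * exp (- ((1/2 - \<beta>) * x\<^sup>2))"
        by (simp add: e_def powr_def flip: exp_add) (simp add: algebra_simps)
      finally show ?thesis using ge(2)[of x] by simp
    qed
    have h4: "w / e x * u (T x) = (w / e x * (norm (D' (T x)))\<^sup>2) / 6 + w / e x * r powr (- \<alpha>)"
      by (simp add: u_def r_def distrib_left)
    have h5: "kepler_const \<alpha> * ((1/6) powr \<beta> * (1/w) powr (2*\<beta>) * w) * exp (- ((1/2 - \<beta>) * x\<^sup>2))
        = w / e x * (kepler_const \<alpha> * A powr \<beta>)"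
      using pw by (simp add: mult_ac)
    have h6: "w / e x * (A * r\<^sup>2 + r powr (- \<alpha>)) = w / e x * (A * r\<^sup>2) + w / e x * r powr (- \<alpha>)"
      by (rule distrib_left)
    have lin: "B / 6 + K \<le> U" if "R \<le> N - B" "Q = R / 6" "K' \<le> S" "U = N / 6 + V" "K = K'" "S = Q + V"
      for B K U R N Q K' S V :: real using that by linarith
    show ?thesis by (rule lin[OF h1 h2 h3 h4 h5 h6])
  qed
  have Gint: "((\<lambda>x. exp (- ((1/2 - \<beta>) * x\<^sup>2))) has_integral trunc_gauss (1/2 - \<beta>) X) {- X..X}"
    unfolding trunc_gauss_def by (intro integrable_integral integrable_continuous_real continuous_intros)
  have "((D (T X) \<bullet> D (T X)) * P X - (D (T (- X)) \<bullet> D (T (- X))) * P (- X)) / 6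
      + kepler_const \<alpha> * ((1/6) powr \<beta> * (1/w) powr (2*\<beta>) * w) * trunc_gauss (1/2 - \<beta>) X
    \<le> integral {s..s+pi} u"
    by (rule has_integral_le[OF has_integral_add[OF has_integral_divide[OF Bint] has_integral_mult_right[OF Gint]] sub])
      (rule pt)
  \<comment> \<open>\<open>P\<close> is odd and \<open>D\<close> has the same norm at both ends, so
    the two boundary terms add up.\<close>
  moreover have "((D (T X) \<bullet> D (T X)) * P X - (D (T (- X)) \<bullet> D (T (- X))) * P (- X)) / 6
      = - (X * exp (X\<^sup>2/2) / (3*w) * (norm (D s))\<^sup>2)"
    using w by (simp add: Tm TX per P_def e_def flip: power2_norm_eq_inner)
  ultimately show ?thesis by (simp add: u_def[abs_def] mult.assoc)
qed

section \<open>The action and the collision level\<close>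

definition chord :: "(real \<Rightarrow> 'a::real_vector) \<Rightarrow> real \<Rightarrow> 'a" where
  "chord f t = f t - f (t + 2*pi/3)"

text \<open>The derivative is carried as a second argument. One chord controls all mutual distances,
  since the others are its translates by one and two thirds of the period.\<close>

definition admissible :: "(real \<Rightarrow> real ^ 2) \<Rightarrow> (real \<Rightarrow> real ^ 2) \<Rightarrow> bool" where
  "admissible f f' \<longleftrightarrow> eight_symmetric f \<and> (\<forall>t. (f has_vector_derivative f' t) (at t)) \<and>
    continuous_on UNIV f' \<and> (\<forall>t. chord f t \<noteq> 0)"

text \<open>For periodic loops this is one third of the three-body action with unit masses: the
  three bodies contribute equally, and so do the three pairs.\<close>

definition action :: "real \<Rightarrow> (real \<Rightarrow> real ^ 2) \<Rightarrow> (real \<Rightarrow> real ^ 2) \<Rightarrow> real" where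
  "action \<alpha> f f' = integral {0..2*pi} (\<lambda>t. (norm (f' t))\<^sup>2 / 2 + norm (chord f t) powr (- \<alpha>))"

lemma continuous_chord:
  fixes f :: "real \<Rightarrow> 'a::real_normed_vector"
  assumes "continuous_on UNIV f"
  shows "continuous_on S (chord f)"
  unfolding chord_def
  by (intro continuous_on_diff continuous_on_shift[OF assms] continuous_on_subset[OF assms]) auto

lemma chord_has_vector_derivative:
  assumes "\<And>t. (f has_vector_derivative f' t) (at t)"
  shows "(chord f has_vector_derivative chord f' t) (at t)"
  unfolding chord_def[abs_def]
  by (intro has_vector_derivative_diff has_vector_derivative_shift_arg assms)

lemma eight_symmetric_period: "eight_symmetric f \<Longrightarrow> period (2*pi) f"
  by (simp add: period_def eight_symmetricD)

lemma period_chord: "period p f \<Longrightarrow> period p (chord f)"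
  using period_shift[of p f "2*pi/3"] by (simp add: period_def chord_def)

text \<open>The two sides differ by \<open>(norm (a + b + c))\<^sup>2\<close>, by Leibniz's
  identity.\<close>

lemma norm_triangle_sides_le:
  fixes a b c :: "'a::real_inner"
  shows "(norm (a - b))\<^sup>2 + (norm (b - c))\<^sup>2 + (norm (c - a))\<^sup>2 \<le> 3 * ((norm a)\<^sup>2 + (norm b)\<^sup>2 + (norm c)\<^sup>2)"
proof -
  have "3 * ((norm a)\<^sup>2 + (norm b)\<^sup>2 + (norm c)\<^sup>2)
      - ((norm (a - b))\<^sup>2 + (norm (b - c))\<^sup>2 + (norm (c - a))\<^sup>2) = (norm (a + b + c))\<^sup>2"
    unfolding power2_norm_eq_inner
    by (simp add: inner_add_left inner_add_right inner_diff_left inner_diff_right inner_commute algebra_simps)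
  then show ?thesis by (smt (verit) zero_le_power2)
qed

text \<open>Leibniz's identity for the three velocities holds at each time; over a full period the
  three translates have equal integrals.\<close>

lemma energy_ge_chord_energy:
  fixes v :: "real \<Rightarrow> real ^ 2"
  assumes v: "continuous_on UNIV v" and p: "period (2*pi) v"
  shows "integral {0..2*pi} (\<lambda>t. (norm (chord v t))\<^sup>2) \<le> 3 * integral {0..2*pi} (\<lambda>t. (norm (v t))\<^sup>2)"
proof -
  define k q where "k t = (norm (v t))\<^sup>2" and "q t = (norm (chord v t))\<^sup>2" for t
  have kc: "continuous_on UNIV k" unfolding k_def by (intro continuous_intros v)
  have qc: "continuous_on UNIV q" unfolding q_def by (intro continuous_intros continuous_chord v)
  have kp: "period (2*pi) k" and qp: "period (2*pi) q"
    using p period_chord[OF p] by (simp_all add: period_def k_def q_def)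
  have pt: "q t + q (t + 2*pi/3) + q (t + 4*pi/3) \<le> 3 * (k t + k (t + 2*pi/3) + k (t + 4*pi/3))" for t
  proof -
    have "v (t + 4*pi/3 + 2*pi/3) = v t"
      using p by (simp add: period_def algebra_simps)
    then show ?thesis
      using norm_triangle_sides_le[of "v t" "v (t + 2*pi/3)" "v (t + 4*pi/3)"]
      by (simp add: q_def k_def chord_def algebra_simps)
  qed
  have si: "((\<lambda>t. h (t + c)) has_integral integral {0..2*pi} h) {0..2*pi}"
    if "continuous_on UNIV h" "period (2*pi) h" for h :: "real \<Rightarrow> real" and c
    using integral_period_shift(1)[OF that, of c] continuous_integrable[OF continuous_on_shift[OF that(1)], of c 0 "2*pi"]
    by (simp add: has_integral_iff)
  have si0: "(h has_integral integral {0..2*pi} h) {0..2*pi}"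
    if "continuous_on UNIV h" for h :: "real \<Rightarrow> real"
    using that by (intro integrable_integral continuous_integrable)
  have "integral {0..2*pi} q + integral {0..2*pi} q + integral {0..2*pi} q
    \<le> 3 * (integral {0..2*pi} k + integral {0..2*pi} k + integral {0..2*pi} k)"
    by (rule has_integral_le[OF has_integral_add[OF has_integral_add[OF si0 si] si]
          has_integral_mult_right[OF has_integral_add[OF has_integral_add[OF si0 si] si]]])
      (use kc qc kp qp pt in auto)
  then show ?thesis by (simp add: q_def[abs_def] k_def[abs_def])
qed

lemma admissibleD:
  assumes "admissible f f'"
  shows "eight_symmetric f" "(f has_vector_derivative f' t) (at t)" "continuous_on S f'"
    "chord f t \<noteq> 0" "continuous_on S f" "period (2*pi) f'" "period (2*pi) f"
    "f' (t + pi) = mirror (f' t)"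
proof -
  show 1: "eight_symmetric f" "(f has_vector_derivative f' t) (at t)" "continuous_on S f'" "chord f t \<noteq> 0"
    for t S using assms continuous_on_subset by (auto simp: admissible_def)
  show "continuous_on S f" using 1(2) by (rule continuous_on_of_derivative)
  show "period (2*pi) f" using 1(1) by (rule eight_symmetric_period)
  then show "period (2*pi) f'" using 1(2) by (rule period_deriv[rotated])
  have "((\<lambda>s. mirror (f s)) has_vector_derivative f' (t + pi)) (at t)"
    using has_vector_derivative_shift_arg[OF 1(2), of pi t] eight_symmetricD(1)[OF 1(1)] by simp
  moreover have "((\<lambda>s. mirror (f s)) has_vector_derivative mirror (f' t)) (at t)"
    using bounded_linear.has_vector_derivative[OF bounded_linear_mirror 1(2)] by simp
  ultimately show "f' (t + pi) = mirror (f' t)" by (rule vector_derivative_unique_at)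
qed

text \<open>The factor of \<open>kepler_const \<alpha>\<close> in \<open>arc_action_ge\<close>, with
  \<open>w\<close> written out.\<close>

definition hardy_level :: "real \<Rightarrow> real \<Rightarrow> real" where
  "hardy_level \<beta> X = (1/6) powr \<beta> * (1 / (pi / trunc_gauss (1/2) X)) powr (2*\<beta>)
    * (pi / trunc_gauss (1/2) X) * trunc_gauss (1/2 - \<beta>) X"

lemma action_integrand_continuous:
  assumes "admissible f f'"
  shows "continuous_on S (\<lambda>t. (norm (f' t))\<^sup>2 / 2)" "continuous_on S (\<lambda>t. norm (chord f t) powr (- \<alpha>))"
    "continuous_on S (\<lambda>t. (norm (chord f' t))\<^sup>2)"
proof -
  note a = admissibleD[OF assms]
  show "continuous_on S (\<lambda>t. (norm (f' t))\<^sup>2 / 2)" "continuous_on S (\<lambda>t. norm (chord f t) powr (- \<alpha>))"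
    "continuous_on S (\<lambda>t. (norm (chord f' t))\<^sup>2)"
    by (intro continuous_intros continuous_chord a; simp add: a)+
qed

text \<open>A shift by \<open>pi\<close> merely reflects the chord, so the arc from any
  \<open>s\<close> to \<open>s + pi\<close> carries half of the integral over the period. The weight
  1/6 arises from 1/2 through \<open>energy_ge_chord_energy\<close>.\<close>

lemma action_ge_collision_level:
  assumes adm: "admissible f f'" and "0 < \<alpha>" "0 < X"
  shows "2 * (kepler_const \<alpha> * hardy_level (\<alpha> / (\<alpha> + 2)) X
      - X * exp (X\<^sup>2/2) / (3 * (pi / trunc_gauss (1/2) X)) * (norm (chord f s))\<^sup>2) \<le> action \<alpha> f f'"
proof -
  note a = admissibleD[OF adm]
  note c = action_integrand_continuous[OF adm]
  define u where "u t = (norm (chord f' t))\<^sup>2 / 6 + norm (chord f t) powr (- \<alpha>)" for t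
  have uc: "continuous_on S u" for S unfolding u_def by (intro continuous_intros c) auto
  have cp: "chord f (t + pi) = mirror (chord f t)" "chord f' (t + pi) = mirror (chord f' t)" for t
    using eight_symmetricD(1)[OF a(1), of t] eight_symmetricD(1)[OF a(1), of "t + 2*pi/3"]
      a(8)[of t] a(8)[of "t + 2*pi/3"] by (simp_all add: chord_def add_ac)
  have up: "period pi u" by (simp add: period_def u_def cp)
  have "kepler_const \<alpha> * hardy_level (\<alpha> / (\<alpha> + 2)) X
      - X * exp (X\<^sup>2/2) / (3 * (pi / trunc_gauss (1/2) X)) * (norm (chord f s))\<^sup>2 \<le> integral {s..s+pi} u"
    using arc_action_ge[of "chord f" "chord f'" s \<alpha> X]
      chord_has_vector_derivative[OF a(2)] continuous_chord[OF a(3)] a(4) cp assms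
    unfolding u_def[abs_def] hardy_level_def by simp
  also have "\<dots> = integral {0..pi} u" by (rule integral_period_shift(2)[OF uc up]) simp
  finally have 1: "kepler_const \<alpha> * hardy_level (\<alpha> / (\<alpha> + 2)) X
      - X * exp (X\<^sup>2/2) / (3 * (pi / trunc_gauss (1/2) X)) * (norm (chord f s))\<^sup>2 \<le> integral {0..pi} u" .
  have "integral {0..pi} u + integral {pi..2*pi} u = integral {0..2*pi} u"
    by (intro Henstock_Kurzweil_Integration.integral_combine continuous_integrable uc) auto
  moreover have "integral {pi..2*pi} u = integral {0..pi} u"
    using integral_period_shift(2)[OF uc up, of pi] by simp
  ultimately have 2: "integral {0..2*pi} u = 2 * integral {0..pi} u" by simp
  have "integral {0..2*pi} u = integral {0..2*pi} (\<lambda>t. (norm (chord f' t))\<^sup>2) / 6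
      + integral {0..2*pi} (\<lambda>t. norm (chord f t) powr (- \<alpha>))"
    unfolding u_def
    by (subst Henstock_Kurzweil_Integration.integral_add)
      (auto intro!: continuous_integrable continuous_intros c)
  also have "\<dots> \<le> integral {0..2*pi} (\<lambda>t. (norm (f' t))\<^sup>2) / 2
      + integral {0..2*pi} (\<lambda>t. norm (chord f t) powr (- \<alpha>))"
    using energy_ge_chord_energy[OF a(3,6)] by simp
  also have "\<dots> = action \<alpha> f f'"
    unfolding action_def
    by (subst Henstock_Kurzweil_Integration.integral_add)
      (auto intro!: continuous_integrable continuous_intros c a)
  finally show ?thesis using 1 2 by simp
qed

section \<open>The limit of the collision level and the Lissajous competitor\<close>

lemma integral_double_frequency:
  fixes h :: "real \<Rightarrow> real"
  assumes h: "continuous_on UNIV h" and p: "period (2*pi) h"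
  shows "((\<lambda>t. h (2*t + c)) has_integral integral {0..2*pi} h) {0..2*pi}"
proof -
  have hs: "continuous_on S (\<lambda>t. h (t + c))" for S by (rule continuous_on_shift[OF h])
  have ps: "period (2*pi) (\<lambda>t. h (t + c))" using p by (rule period_shift)
  \<comment> \<open>The doubled argument covers two periods, which compensates the factor 2 of the
    substitution.\<close>
  have "((\<lambda>t. 2 *\<^sub>R h (2*t + c)) has_integral integral {2*0..2*(2*pi)} (\<lambda>t. h (t + c))) {0..2*pi}"
    by (rule has_integral_substitution[of 0 "2*pi" "\<lambda>t. 2*t" 0 "4*pi"])
      (auto intro!: hs derivative_eq_intros)
  moreover have "integral {0..2*pi} (\<lambda>t. h (t + c)) + integral {2*pi..4*pi} (\<lambda>t. h (t + c)) = integral {0..4*pi} (\<lambda>t. h (t + c))"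
    by (intro Henstock_Kurzweil_Integration.integral_combine continuous_integrable hs) auto
  moreover have "integral {2*pi..4*pi} (\<lambda>t. h (t + c)) = integral {0..2*pi} (\<lambda>t. h (t + c))"
    using integral_period_shift(2)[OF hs ps, of "2*pi"] by simp
  moreover have "integral {0..2*pi} (\<lambda>t. h (t + c)) = integral {0..2*pi} h"
    by (rule integral_period_shift(1)[OF h p]) simp
  ultimately have "((\<lambda>t. 2 * h (2*t + c)) has_integral (2 * integral {0..2*pi} h)) {0..2*pi}"
    by simp
  from has_integral_mult_right[OF this, of "1/2"] show ?thesis by simp
qed

text \<open>\<open>pi / trunc_gauss (1/2) X\<close> tends to \<open>sqrt (pi / 2)\<close>. The power
  of its reciprocal joins \<open>(1/6) powr \<beta>\<close> to
  \<open>(1 / (3*pi)) powr \<beta>\<close>, and the second Gaussian integral brings in the factor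
  that blows up at \<open>\<beta> = 1/2\<close>.\<close>

lemma hardy_level_tendsto:
  assumes "0 < \<beta>" "\<beta> < 1/2"
  shows "(\<lambda>n. hardy_level \<beta> (real n)) \<longlonglongrightarrow> pi * ((1 / (3*pi)) powr \<beta> * (1 / sqrt (1 - 2*\<beta>)))"
proof -
  have Z: "(\<lambda>n. trunc_gauss (1/2) (real n)) \<longlonglongrightarrow> sqrt (pi / (1/2))"
    and G: "(\<lambda>n. trunc_gauss (1/2 - \<beta>) (real n)) \<longlonglongrightarrow> sqrt (pi / (1/2 - \<beta>))"
    unfolding trunc_gauss_def using assms by (intro integral_gaussian_tendsto; simp)+
  have "(\<lambda>n. hardy_level \<beta> (real n)) \<longlonglongrightarrow>
      (1/6) powr \<beta> * (1 / (pi / sqrt (pi / (1/2)))) powr (2*\<beta>) * (pi / sqrt (pi / (1/2))) * sqrt (pi / (1/2 - \<beta>))"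
    unfolding hardy_level_def by (intro tendsto_intros Z G) auto
  also have "(1 / (pi / sqrt (pi / (1/2)))) powr (2*\<beta>) = (2 / pi) powr \<beta>"
  proof -
    have "(1 / (pi / sqrt (pi / (1/2)))) powr (2*\<beta>) = ((1 / (pi / sqrt (pi / (1/2)))) powr 2) powr \<beta>"
      by (simp only: powr_powr)
    also have "(1 / (pi / sqrt (pi / (1/2)))) powr 2 = 2 / pi"
      by (simp add: powr_numeral power_divide power2_eq_square)
    finally show ?thesis .
  qed
  also have "(1/6) powr \<beta> * (2 / pi) powr \<beta> = (1 / (3*pi)) powr \<beta>"
    by (simp flip: powr_mult)
  also have "(1 / (3*pi)) powr \<beta> * (pi / sqrt (pi / (1/2))) * sqrt (pi / (1/2 - \<beta>))
      = pi * ((1 / (3*pi)) powr \<beta> * (1 / sqrt (1 - 2*\<beta>)))"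
  proof -
    have "pi / (1/2 - \<beta>) = (pi / (1/2)) / (1 - 2*\<beta>)" using assms by (simp add: field_simps)
    then have "sqrt (pi / (1/2 - \<beta>)) = sqrt (pi / (1/2)) / sqrt (1 - 2*\<beta>)"
      by (simp only: real_sqrt_divide)
    then show ?thesis by simp
  qed
  finally show ?thesis .
qed

definition lissajous :: "real \<Rightarrow> real \<Rightarrow> real ^ 2" where
  "lissajous A t = vector [A * sin (2*t), 2 * sqrt 2 * A * sin t]"

definition lissajous' :: "real \<Rightarrow> real \<Rightarrow> real ^ 2" where
  "lissajous' A t = vector [A * 2 * cos (2*t), 2 * sqrt 2 * A * cos t]"

lemma norm_vec2: "norm (v :: real ^ 2) = sqrt ((v $ 1)\<^sup>2 + (v $ 2)\<^sup>2)"
  by (simp add: norm_eq_sqrt_inner inner_vec_def sum_2 power2_eq_square)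

lemma has_vector_derivative_vec2:
  fixes f :: "real \<Rightarrow> real ^ 2"
  assumes "((\<lambda>t. f t $ 1) has_real_derivative d $ 1) (at t)" "((\<lambda>t. f t $ 2) has_real_derivative d $ 2) (at t)"
  shows "(f has_vector_derivative d) (at t)"
proof -
  have "((\<lambda>t. (f t $ 1) *\<^sub>R axis 1 1 + (f t $ 2) *\<^sub>R axis 2 1 :: real ^ 2) has_vector_derivative
      (d $ 1) *\<^sub>R axis 1 1 + (d $ 2) *\<^sub>R axis 2 1) (at t)"
    using assms
    by (intro has_vector_derivative_add has_vector_derivative_scaleR[where g' = 0, simplified] derivative_intros) auto
  moreover have "(v $ 1) *\<^sub>R axis 1 1 + (v $ 2) *\<^sub>R axis 2 1 = v" for v :: "real ^ 2"
    by (rule vec2_eqI) (auto simp: axis_def)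
  ultimately show ?thesis by simp
qed

text \<open>The ratio \<open>2 \<surd>2\<close> of the two amplitudes turns \<open>\<bar>f t - f (t + 2\<pi>/3)\<bar>\<^sup>2\<close> into a perfect square.\<close>

lemma norm_chord_lissajous:
  assumes "0 < A"
  shows "norm (chord (lissajous A) t) = sqrt 3 * A * (2 + cos (2*t + 2*pi/3))"
proof -
  define u where "u = t + pi/3"
  have s3: "sin (2*pi/3) = sqrt 3 / 2" using sin_120 by simp
  have x: "chord (lissajous A) t $ 1 = - (sqrt 3 * A * cos (2*u))"
  proof -
    have "sin (2*t) - sin (2*(t + 2*pi/3)) = 2 * sin ((2*t - 2*(t + 2*pi/3)) / 2) * cos ((2*t + 2*(t + 2*pi/3)) / 2)"
      by (rule sin_diff_sin)
    also have "(2*t - 2*(t + 2*pi/3)) / 2 = - (2*pi/3)" by simp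
    also have "(2*t + 2*(t + 2*pi/3)) / 2 = 2*u" by (simp add: u_def)
    finally have "sin (2*t) - sin (2*(t + 2*pi/3)) = - sqrt 3 * cos (2*u)" unfolding sin_minus s3 by simp
    then have "A * (sin (2*t) - sin (2*(t + 2*pi/3))) = A * (- sqrt 3 * cos (2*u))" by simp
    then show ?thesis by (simp add: chord_def lissajous_def algebra_simps)
  qed
  have y: "chord (lissajous A) t $ 2 = - (2 * sqrt 2 * sqrt 3 * A * cos u)"
  proof -
    have "sin t - sin (t + 2*pi/3) = 2 * sin ((t - (t + 2*pi/3)) / 2) * cos ((t + (t + 2*pi/3)) / 2)"
      by (rule sin_diff_sin)
    also have "(t - (t + 2*pi/3)) / 2 = - (pi/3)" by simp
    also have "(t + (t + 2*pi/3)) / 2 = u" by (simp add: u_def)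
    finally have "sin t - sin (t + 2*pi/3) = - sqrt 3 * cos u" by (simp add: sin_60)
    then have "2 * sqrt 2 * A * (sin t - sin (t + 2*pi/3)) = 2 * sqrt 2 * A * (- sqrt 3 * cos u)" by simp
    then show ?thesis by (simp add: chord_def lissajous_def algebra_simps)
  qed
  have "(chord (lissajous A) t $ 1)\<^sup>2 + (chord (lissajous A) t $ 2)\<^sup>2 = (sqrt 3 * A * (2 + cos (2*u)))\<^sup>2"
    unfolding x y by (simp add: power_mult_distrib cos_double_cos) (simp add: power2_eq_square algebra_simps)
  then have "norm (chord (lissajous A) t) = sqrt 3 * A * (2 + cos (2*u))"
    unfolding norm_vec2 using assms two_plus_cos_bounds[of "2*u"] by (simp add: real_sqrt_abs abs_mult)
  then show ?thesis by (simp add: u_def algebra_simps)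
qed

lemma admissible_lissajous:
  assumes "0 < A"
  shows "admissible (lissajous A) (lissajous' A)"
  unfolding admissible_def
proof (intro conjI allI)
  show "eight_symmetric (lissajous A)"
    unfolding eight_symmetric_def
    by (auto simp: lissajous_def distrib_left sin_add intro!: vec2_eqI)
  show "(lissajous A has_vector_derivative lissajous' A t) (at t)" for t
    by (rule has_vector_derivative_vec2) (auto simp: lissajous_def lissajous'_def intro!: derivative_eq_intros)
  show "continuous_on UNIV (lissajous' A)"
    unfolding continuous_on_componentwise[where f = "lissajous' A"]
    by (auto simp: Basis_vec_def inner_axis lissajous'_def forall_2 intro!: continuous_intros)
  show "chord (lissajous A) t \<noteq> 0" for t
    using norm_chord_lissajous[OF assms, of t] two_plus_cos_bounds(3)[of "2*t + 2*pi/3"] assms by auto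
qed

text \<open>The kinetic part is \<open>6 * pi * A\<^sup>2 = 2 * pi * (sqrt 3 * A)\<^sup>2\<close>;
  thus \<open>sqrt 3 * A\<close> acts as the radius of \<open>kepler_scaling\<close>.\<close>

lemma action_lissajous:
  assumes "0 < A"
  shows "action \<alpha> (lissajous A) (lissajous' A)
    = 2 * pi * ((sqrt 3 * A)\<^sup>2 + (sqrt 3 * A) powr (- \<alpha>) * mean_potential \<alpha>)"
proof -
  have cc: "integral {0..2*pi} (\<lambda>u. (cos u)\<^sup>2) = pi"
    using integral_cos_power[of 0] by (simp add: power2_eq_square)
  have "((\<lambda>u. (cos u)\<^sup>2) has_integral pi) {0..2*pi}"
    unfolding has_integral_iff using cc by (auto intro!: integrable_continuous_real continuous_intros)
  moreover have "((\<lambda>u. (cos (2*u + 0))\<^sup>2) has_integral pi) {0..2*pi}"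
  proof -
    have "continuous_on UNIV (\<lambda>u::real. (cos u)\<^sup>2)" by (intro continuous_intros)
    from integral_double_frequency[OF this, of 0] show ?thesis using cc by (simp add: period_def)
  qed
  ultimately have "((\<lambda>t. 2 * A\<^sup>2 * (cos (2*t + 0))\<^sup>2 + 4 * A\<^sup>2 * (cos t)\<^sup>2) has_integral
      (2 * A\<^sup>2 * pi + 4 * A\<^sup>2 * pi)) {0..2*pi}"
    by (intro has_integral_add has_integral_mult_right)
  moreover have "2 * A\<^sup>2 * (cos (2*t + 0))\<^sup>2 + 4 * A\<^sup>2 * (cos t)\<^sup>2 = (norm (lissajous' A t))\<^sup>2 / 2" for t
    unfolding norm_vec2 by (simp add: lissajous'_def power_mult_distrib)
  ultimately have K: "((\<lambda>t. (norm (lissajous' A t))\<^sup>2 / 2) has_integral (2 * A\<^sup>2 * pi + 4 * A\<^sup>2 * pi)) {0..2*pi}"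
    by (simp only:)
  have "((\<lambda>t. (2 + cos (2*t + 2*pi/3)) powr (- \<alpha>)) has_integral (2 * pi * mean_potential \<alpha>)) {0..2*pi}"
    using integral_double_frequency[of "\<lambda>u. (2 + cos u) powr (- \<alpha>)" "2*pi/3"] two_plus_cos_bounds(3)
    by (simp add: mean_potential_def period_def less_imp_neq[symmetric] continuous_intros)
  then have "((\<lambda>t. (sqrt 3 * A) powr (- \<alpha>) * (2 + cos (2*t + 2*pi/3)) powr (- \<alpha>)) has_integral
      ((sqrt 3 * A) powr (- \<alpha>) * (2 * pi * mean_potential \<alpha>))) {0..2*pi}"
    by (rule has_integral_mult_right)
  moreover have "(sqrt 3 * A) powr (- \<alpha>) * (2 + cos (2*t + 2*pi/3)) powr (- \<alpha>)
      = norm (chord (lissajous A) t) powr (- \<alpha>)" for t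
    unfolding norm_chord_lissajous[OF assms]
    using assms two_plus_cos_bounds[of "2*t + 2*pi/3"] by (simp add: powr_mult)
  ultimately have V: "((\<lambda>t. norm (chord (lissajous A) t) powr (- \<alpha>)) has_integral
      ((sqrt 3 * A) powr (- \<alpha>) * (2 * pi * mean_potential \<alpha>))) {0..2*pi}"
    by simp
  show ?thesis
    unfolding action_def using integral_unique[OF has_integral_add[OF K V]]
    by (simp add: power_mult_distrib algebra_simps)
qed

text \<open>The limiting inequality is strict, so it survives a large finite truncation
  \<open>X\<close> and a merely almost optimal amplitude.\<close>

lemma exists_action_below_collision_level:
  assumes "0 < \<alpha>" "\<alpha> < 2"
  obtains X f f' where "0 < X" "admissible f f'"
    "action \<alpha> f f' < 2 * (kepler_const \<alpha> * hardy_level (\<alpha> / (\<alpha> + 2)) X)"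
proof -
  define \<beta> where "\<beta> = \<alpha> / (\<alpha> + 2)"
  have b: "0 < \<beta>" "\<beta> < 1/2" using assms by (auto simp: \<beta>_def field_simps)
  have a: "\<alpha> = 2 * \<beta> / (1 - \<beta>)" using assms by (simp add: \<beta>_def field_simps)
  define M where "M = mean_potential \<alpha>"
  have M: "0 < M" using mean_potential_le[OF assms(1)] by (simp add: M_def)
  have "pi * M powr (1 - \<beta>) < pi * ((1 / (3*pi)) powr \<beta> * (1 / sqrt (1 - 2*\<beta>)))"
    unfolding M_def by (intro mult_strict_left_mono mean_potential_powr_less[OF b a]) simp
  from order_tendstoD(1)[OF hardy_level_tendsto[OF b] this]
  have "\<forall>\<^sub>F n in sequentially. 0 < real n \<and> pi * M powr (1 - \<beta>) < hardy_level \<beta> (real n)"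
    using eventually_gt_at_top[of 0] by eventually_elim auto
  then obtain X where X: "0 < X" "pi * M powr (1 - \<beta>) < hardy_level \<beta> X"
    using eventually_happens'[OF sequentially_bot] by blast
  have c: "0 < kepler_const \<alpha>" using kepler_const_ge_1[OF assms(1)] by simp
  have pM: "0 < pi * M powr (1 - \<beta>)" using M by simp
  have "kepler_const \<alpha> < kepler_const \<alpha> * hardy_level \<beta> X / (pi * M powr (1 - \<beta>))"
    using X(2) c pM by (simp add: field_simps)
  then obtain \<mu> where \<mu>: "0 < \<mu>"
      "\<mu>\<^sup>2 + \<mu> powr (- \<alpha>) < kepler_const \<alpha> * hardy_level \<beta> X / (pi * M powr (1 - \<beta>))"
    using kepler_const_less[OF assms(1)] by blast
  \<comment> \<open>Undoes the rescaling of \<open>kepler_scaling\<close> for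
    \<open>A = 1/M\<close>, so that the rescaled radius is \<open>\<mu>\<close>.\<close>
  define l where "l = \<mu> / (1/M) powr (1 / (\<alpha> + 2))"
  have l: "0 < l" using \<mu> M by (simp add: l_def)
  have "M * (1/M * l\<^sup>2 + l powr (- \<alpha>)) = M * ((1/M) powr \<beta> * (\<mu>\<^sup>2 + \<mu> powr (- \<alpha>)))"
    using kepler_scaling[of "1/M" l \<alpha>] M l assms by (simp add: l_def \<beta>_def)
  also have "\<dots> = M powr (1 - \<beta>) * (\<mu>\<^sup>2 + \<mu> powr (- \<alpha>))"
    using M by (simp add: powr_diff powr_divide)
  finally have "l\<^sup>2 + l powr (- \<alpha>) * M = M powr (1 - \<beta>) * (\<mu>\<^sup>2 + \<mu> powr (- \<alpha>))"
    using M by (simp add: algebra_simps)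
  then have "pi * (l\<^sup>2 + l powr (- \<alpha>) * M) < kepler_const \<alpha> * hardy_level \<beta> X"
    using \<mu>(2) pM by (simp add: field_simps)
  moreover have "sqrt 3 * (l / sqrt 3) = l" by simp
  ultimately have "action \<alpha> (lissajous (l / sqrt 3)) (lissajous' (l / sqrt 3)) < 2 * (kepler_const \<alpha> * hardy_level \<beta> X)"
    using action_lissajous[of "l / sqrt 3" \<alpha>] l by (simp add: M_def)
  then show thesis
    using that[OF X(1) admissible_lissajous[of "l / sqrt 3"]] l by (simp add: \<beta>_def)
qed

section \<open>Minimizing sequences\<close>

text \<open>Choose a level strictly between the competitor and the collision level: a small chord
  anywhere would lift the action above it by \<open>action_ge_collision_level\<close>.\<close>

lemma chord_bounded_below:
  assumes "0 < \<alpha>" "\<alpha> < 2"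
  obtains \<delta> f\<^sub>0 f\<^sub>0' \<Lambda> where "0 < \<delta>" "admissible f\<^sub>0 f\<^sub>0'" "action \<alpha> f\<^sub>0 f\<^sub>0' < \<Lambda>"
    "\<forall>f f' t. admissible f f' \<longrightarrow> action \<alpha> f f' < \<Lambda> \<longrightarrow> \<delta> \<le> norm (chord f t)"
proof -
  obtain X f\<^sub>0 f\<^sub>0' where X: "0 < X" and adm: "admissible f\<^sub>0 f\<^sub>0'"
    and less: "action \<alpha> f\<^sub>0 f\<^sub>0' < 2 * (kepler_const \<alpha> * hardy_level (\<alpha> / (\<alpha> + 2)) X)"
    using exists_action_below_collision_level[OF assms] .
  define L where "L = kepler_const \<alpha> * hardy_level (\<alpha> / (\<alpha> + 2)) X"
  define K where "K = X * exp (X\<^sup>2/2) / (3 * (pi / trunc_gauss (1/2) X))"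
  have K: "0 < K" using X trunc_gauss_pos[OF X] by (simp add: K_def)
  define \<Lambda> where "\<Lambda> = (action \<alpha> f\<^sub>0 f\<^sub>0' + 2 * L) / 2"
  have \<Lambda>: "action \<alpha> f\<^sub>0 f\<^sub>0' < \<Lambda>" "\<Lambda> < 2 * L" using less by (auto simp: \<Lambda>_def L_def)
  \<comment> \<open>The solution of
    \<open>2 * (L - K * \<delta>\<^sup>2) = \<Lambda>\<close>.\<close>
  define \<delta> where "\<delta> = sqrt ((2 * L - \<Lambda>) / (2 * K))"
  have \<delta>: "0 < \<delta>" "2 * K * \<delta>\<^sup>2 = 2 * L - \<Lambda>" using \<Lambda> K by (simp_all add: \<delta>_def)
  show thesis
  proof (rule that[OF \<delta>(1) adm \<Lambda>(1)], intro allI impI)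
    fix f f' t assume f: "admissible f f'" "action \<alpha> f f' < \<Lambda>"
    show "\<delta> \<le> norm (chord f t)"
    proof (rule ccontr)
      assume "\<not> ?thesis"
      then have "(norm (chord f t))\<^sup>2 \<le> \<delta>\<^sup>2" by (intro power_mono) auto
      then have "2 * K * (norm (chord f t))\<^sup>2 \<le> 2 * K * \<delta>\<^sup>2" using K by simp
      moreover have "2 * (L - K * (norm (chord f t))\<^sup>2) \<le> action \<alpha> f f'"
        using action_ge_collision_level[OF f(1) assms(1) X] by (simp add: L_def K_def)
      ultimately show False using \<delta>(2) f(2) by simp
    qed
  qed
qed

lemma action_nonneg: "admissible f f' \<Longrightarrow> 0 \<le> action \<alpha> f f'"
  unfolding action_def
  by (intro integral_nonneg continuous_integrable continuous_on_add action_integrand_continuous) auto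

text \<open>Young's inequality with a free \<open>l\<close> takes the place of Cauchy-Schwarz: a
  large \<open>l\<close> makes the second term small, then a short interval the first.\<close>

lemma admissible_modulus_of_continuity:
  assumes adm: "admissible f f'" and A: "action \<alpha> f f' \<le> \<Lambda>" and "0 \<le> s" "s \<le> t" "t \<le> 2*pi" "0 < l"
  shows "norm (f t - f s) \<le> l * (t - s) / 2 + \<Lambda> / l"
proof -
  note a = admissibleD[OF adm]
  note c = action_integrand_continuous[OF adm]
  have "(f' has_integral (f t - f s)) {s..t}"
    using a(2) has_vector_derivative_at_within by (intro fundamental_theorem_of_calculus assms) blast
  then have "norm (f t - f s) = norm (integral {s..t} f')" by (simp add: integral_unique)
  also have "\<dots> \<le> integral {s..t} (\<lambda>x. l/2 + ((norm (f' x))\<^sup>2 / 2) / l)"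
  proof (rule integral_norm_bound_integral)
    show "f' integrable_on {s..t}" "(\<lambda>x. l/2 + ((norm (f' x))\<^sup>2 / 2) / l) integrable_on {s..t}"
      using assms by (auto intro!: continuous_integrable a continuous_intros c)
    fix x
    have "0 \<le> (l - norm (f' x))\<^sup>2 / (2 * l)" using assms by simp
    also have "\<dots> = l/2 + ((norm (f' x))\<^sup>2 / 2) / l - norm (f' x)"
      using assms by (simp add: field_simps power2_eq_square)
    finally show "norm (f' x) \<le> l/2 + ((norm (f' x))\<^sup>2 / 2) / l" by simp
  qed
  also have "\<dots> = l * (t - s) / 2 + integral {s..t} (\<lambda>x. (norm (f' x))\<^sup>2 / 2) / l"
    using assms by (subst Henstock_Kurzweil_Integration.integral_add)
      (auto intro!: continuous_integrable continuous_intros c a)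
  also have "\<dots> \<le> l * (t - s) / 2 + \<Lambda> / l"
  proof -
    have "integral {s..t} (\<lambda>x. (norm (f' x))\<^sup>2 / 2) \<le> integral {0..2*pi} (\<lambda>x. (norm (f' x))\<^sup>2 / 2)"
      using assms by (intro integral_subset_le continuous_integrable c) auto
    also have "\<dots> \<le> action \<alpha> f f'"
      unfolding action_def
      by (intro integral_le continuous_integrable continuous_on_add c) auto
    also note A
    finally show ?thesis using assms by (intro add_left_mono divide_right_mono) auto
  qed
  finally show ?thesis .
qed

text \<open>Arzela-Ascoli on one period. Starting at the origin gives the uniform bound, and
  periodicity extends uniform convergence to the line.\<close>

lemma admissible_compactness:
  fixes f f' :: "nat \<Rightarrow> real \<Rightarrow> real ^ 2"
  assumes adm: "\<And>n. admissible (f n) (f' n)" and A: "\<And>n. action \<alpha> (f n) (f' n) \<le> \<Lambda>"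
  obtains k g M where "strict_mono (k :: nat \<Rightarrow> nat)" "\<forall>t. (\<lambda>n. f (k n) t) \<longlonglongrightarrow> g t"
    "continuous_on UNIV g" "eight_symmetric g" "\<forall>n t. norm (f n t) \<le> M"
proof -
  have \<Lambda>: "0 \<le> \<Lambda>" using action_nonneg[OF adm] A order_trans by blast
  have osc: "norm (f n x - f n y) \<le> l * \<bar>x - y\<bar> / 2 + \<Lambda> / l"
    if "x \<in> {0..2*pi}" "y \<in> {0..2*pi}" "0 < l" for n x y l
    using admissible_modulus_of_continuity[OF adm A, of x y l n] admissible_modulus_of_continuity[OF adm A, of y x l n] that
    by (cases "x \<le> y") (auto simp: norm_minus_commute)
  define M where "M = pi + \<Lambda>"
  have M0: "norm (f n t) \<le> M" if "t \<in> {0..2*pi}" for n t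
    using osc[of t 0 1 n] that eight_symmetricD(4)[OF admissibleD(1)[OF adm[of n]]] by (auto simp: M_def)
  have per: "period (2*pi) (f n)" for n by (rule admissibleD[OF adm])
  have M: "norm (f n t) \<le> M" for n t
  proof -
    obtain s where "0 \<le> s" "s < 2*pi" "f n t = f n s" using period_reduce[OF per, of n t] by auto
    then show ?thesis using M0[of s n] by simp
  qed
  have equi: "\<exists>d. 0 < d \<and> (\<forall>n y. y \<in> {0..2*pi} \<and> norm (x - y) < d \<longrightarrow> norm (f n x - f n y) < e)"
    if "x \<in> {0..2*pi}" "0 < e" for x e
  proof -
    \<comment> \<open>Makes \<open>\<Lambda> / l < e / 2\<close>; the summand 1 keeps
      \<open>l\<close> positive when \<open>\<Lambda> = 0\<close>.\<close>
    define l where "l = (2 * \<Lambda> + 1) / e"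
    have l: "0 < l" "\<Lambda> / l < e / 2" using \<Lambda> that by (auto simp: l_def field_simps)
    show ?thesis
    proof (intro exI[of _ "e / l"] conjI allI impI)
      fix n y assume y: "y \<in> {0..2*pi} \<and> norm (x - y) < e / l"
      then have "l * \<bar>x - y\<bar> < e" using l by (simp add: field_simps)
      moreover have "norm (f n x - f n y) \<le> l * \<bar>x - y\<bar> / 2 + \<Lambda> / l" using osc that y l by blast
      ultimately show "norm (f n x - f n y) < e" using l(2) by linarith
    qed (use l that in simp)
  qed
  obtain h and k :: "nat \<Rightarrow> nat" where h: "continuous_on {0..2*pi} h" "strict_mono k"
    and lim: "\<And>e. 0 < e \<Longrightarrow> \<exists>N. \<forall>n x. n \<ge> N \<and> x \<in> {0..2*pi} \<longrightarrow> norm (f (k n) x - h x) < e"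
    using Arzela_Ascoli[of "{0..2*pi}" f M] M equi by auto
  \<comment> \<open>The limit exists everywhere, as periodicity reduces it to a value of
    \<open>h\<close>.\<close>
  define g where "g t = lim (\<lambda>n. f (k n) t)" for t
  have uni: "\<exists>N. \<forall>n\<ge>N. \<forall>t. norm (f (k n) t - g t) < e" if e: "0 < e" for e
  proof -
    obtain N where N: "\<And>n x. n \<ge> N \<Longrightarrow> x \<in> {0..2*pi} \<Longrightarrow> norm (f (k n) x - h x) < e"
      using lim[OF e] by blast
    have "norm (f (k n) t - g t) < e" if "n \<ge> N" for n t
    proof -
      define s where "s = t + of_int (- \<lfloor>t / (2*pi)\<rfloor>) * (2*pi)"
      have fs: "f m t = f m s" for m unfolding s_def by (rule period_int[OF per, symmetric])
      have "of_int \<lfloor>t / (2*pi)\<rfloor> * (2*pi) \<le> t" "t < (of_int \<lfloor>t / (2*pi)\<rfloor> + 1) * (2*pi)"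
        by (rule floor_divide_lower floor_divide_upper; simp)+
      then have s: "s \<in> {0..2*pi}" by (auto simp: s_def algebra_simps)
      have "(\<lambda>n. f (k n) s) \<longlonglongrightarrow> h s"
        unfolding LIMSEQ_iff using lim s by metis
      then have "g t = h s" unfolding g_def fs by (rule limI)
      then show ?thesis using N[OF that s] fs by simp
    qed
    then show ?thesis by blast
  qed
  have conv: "(\<lambda>n. f (k n) t) \<longlonglongrightarrow> g t" for t
    unfolding LIMSEQ_iff using uni by metis
  have "continuous_on UNIV g"
  proof (rule uniform_limit_theorem)
    show "uniform_limit UNIV (\<lambda>n. f (k n)) g sequentially"
      unfolding uniform_limit_sequentially_iff dist_norm using uni by blast
    show "\<forall>\<^sub>F n in sequentially. continuous_on UNIV (f (k n))"
      using admissibleD(5)[OF adm] by simp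
  qed simp
  moreover have "eight_symmetric g"
    unfolding eight_symmetric_def
  proof (intro allI conjI)
    fix t
    have "(\<lambda>n. mirror (f (k n) t)) \<longlonglongrightarrow> mirror (g t)"
      by (rule bounded_linear.tendsto[OF bounded_linear_mirror conv])
    then have "(\<lambda>n. f (k n) (t + pi)) \<longlonglongrightarrow> mirror (g t)"
      using eight_symmetricD(1)[OF admissibleD(1)[OF adm]] by simp
    then show "g (t + pi) = mirror (g t)" using conv LIMSEQ_unique by blast
    have "(\<lambda>n. f (k n) (- t)) \<longlonglongrightarrow> - g t"
      using tendsto_minus[OF conv[of t]] eight_symmetricD(2)[OF admissibleD(1)[OF adm]] by simp
    then show "g (- t) = - g t" using conv LIMSEQ_unique by blast
  qed
  ultimately show thesis using that[OF h(2)] conv M by blast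
qed

section \<open>The first variation of the action\<close>

lemma integral_by_parts_period:
  fixes p q :: "real \<Rightarrow> 'a::euclidean_space"
  assumes p: "\<And>t. (p has_vector_derivative p' t) (at t)" "continuous_on UNIV p'" "period c p"
    and q: "\<And>t. (q has_vector_derivative q' t) (at t)" "continuous_on UNIV q'" "period c q"
    and "0 \<le> c"
  shows "integral {0..c} (\<lambda>t. p' t \<bullet> q t) = - integral {0..c} (\<lambda>t. p t \<bullet> q' t)"
proof -
  have pc: "continuous_on UNIV p" "continuous_on UNIV q"
    using continuous_on_of_derivative[OF p(1)] continuous_on_of_derivative[OF q(1)] .
  have "((\<lambda>t. p t \<bullet> q' t + p' t \<bullet> q t) has_integral (p c \<bullet> q c - p 0 \<bullet> q 0)) {0..c}"
    by (rule fundamental_theorem_of_calculus[OF assms(7)], rule has_vector_derivative_at_within,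
        rule bounded_bilinear.has_vector_derivative[OF bounded_bilinear_inner p(1) q(1)])
  moreover have "p c = p 0" "q c = q 0"
    using p(3)[unfolded period_def, rule_format, of 0] q(3)[unfolded period_def, rule_format, of 0] by simp_all
  ultimately have "integral {0..c} (\<lambda>t. p t \<bullet> q' t + p' t \<bullet> q t) = 0" by (simp add: integral_unique)
  then show ?thesis
    by (subst (asm) Henstock_Kurzweil_Integration.integral_add)
      (auto intro!: continuous_integrable continuous_intros p q pc)
qed

lemma powr_norm_line_derivative:
  fixes v w :: "'a::real_inner"
  assumes "v + x *\<^sub>R w \<noteq> 0"
  shows "((\<lambda>x. norm (v + x *\<^sub>R w) powr (- \<alpha>)) has_field_derivative
      - \<alpha> * norm (v + x *\<^sub>R w) powr (- \<alpha> - 2) * ((v + x *\<^sub>R w) \<bullet> w)) (at x within S)"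
proof -
  define s where "s x = (v + x *\<^sub>R w) \<bullet> (v + x *\<^sub>R w)" for x
  have s0: "0 < s x" using assms by (simp add: s_def)
  have ns: "norm (v + x *\<^sub>R w) powr a = s x powr (a / 2)" for x a
  proof -
    have "s x = norm (v + x *\<^sub>R w) powr 2" by (simp add: s_def flip: power2_norm_eq_inner)
    then show ?thesis by (simp only: powr_powr) simp
  qed
  have s_eq: "s x = v \<bullet> v + 2 * x * (v \<bullet> w) + x\<^sup>2 * (w \<bullet> w)" for x
    unfolding s_def by (simp add: inner_add_left inner_add_right inner_commute[of w v] power2_eq_square distrib_left mult.assoc)
  have "(s has_field_derivative 2 * ((v + x *\<^sub>R w) \<bullet> w)) (at x within S)"
    unfolding s_eq[abs_def] by (auto intro!: derivative_eq_intros simp: inner_add_left algebra_simps)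
  from DERIV_chain2[OF has_real_derivative_powr[OF s0, of "- \<alpha> / 2"] this]
  have "((\<lambda>x. s x powr (- \<alpha> / 2)) has_field_derivative
      - \<alpha> / 2 * s x powr (- \<alpha> / 2 - 1) * (2 * ((v + x *\<^sub>R w) \<bullet> w))) (at x within S)" .
  moreover have e: "(- \<alpha> - 2) / 2 = - \<alpha> / 2 - 1" by simp
  ultimately show ?thesis unfolding ns e by (simp add: mult.assoc)
qed

lemma chord_add_scaleR: "chord (\<lambda>t. f t + e *\<^sub>R p t) t = chord f t + e *\<^sub>R chord p t"
  by (simp add: chord_def algebra_simps)

lemma admissible_variation:
  assumes adm: "admissible f f'"
    and p: "eight_symmetric p" "\<And>t. (p has_vector_derivative p' t) (at t)" "continuous_on UNIV p'"
    and far: "\<And>t. chord f t + e *\<^sub>R chord p t \<noteq> 0"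
  shows "admissible (\<lambda>t. f t + e *\<^sub>R p t) (\<lambda>t. f' t + e *\<^sub>R p' t)"
  unfolding admissible_def
proof (intro conjI allI)
  note a = admissibleD[OF adm]
  show "eight_symmetric (\<lambda>t. f t + e *\<^sub>R p t)"
    using a(1) p(1) by (simp add: eight_symmetric_def algebra_simps)
  show "((\<lambda>t. f t + e *\<^sub>R p t) has_vector_derivative f' t + e *\<^sub>R p' t) (at t)" for t
    using a(2)[of t] p(2)[of t] by (auto intro!: derivative_eq_intros)
  show "continuous_on UNIV (\<lambda>t. f' t + e *\<^sub>R p' t)" by (intro continuous_intros a p)
  show "chord (\<lambda>t. f t + e *\<^sub>R p t) t \<noteq> 0" for t unfolding chord_add_scaleR by (rule far)
qed

text \<open>The kinetic term is quadratic, so its expansion is exact, and integration by parts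
  leaves \<open>f\<close> undifferentiated in the linear term.\<close>

lemma action_variation:
  assumes adm: "admissible f f'"
    and p: "eight_symmetric p" "\<And>t. (p has_vector_derivative p' t) (at t)"
      "\<And>t. (p' has_vector_derivative p'' t) (at t)" "continuous_on UNIV p''"
    and far: "\<And>t. chord f t + e *\<^sub>R chord p t \<noteq> 0"
  shows "action \<alpha> (\<lambda>t. f t + e *\<^sub>R p t) (\<lambda>t. f' t + e *\<^sub>R p' t) - action \<alpha> f f'
    = - e * integral {0..2*pi} (\<lambda>t. f t \<bullet> p'' t) + e\<^sup>2 * integral {0..2*pi} (\<lambda>t. (norm (p' t))\<^sup>2 / 2)
      + integral {0..2*pi} (\<lambda>t. norm (chord f t + e *\<^sub>R chord p t) powr (- \<alpha>))
      - integral {0..2*pi} (\<lambda>t. norm (chord f t) powr (- \<alpha>))"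
proof -
  note a = admissibleD[OF adm]
  have pc: "continuous_on UNIV p'" "continuous_on UNIV p"
    using continuous_on_of_derivative[OF p(3)] continuous_on_of_derivative[OF p(2)] .
  note adm' = admissible_variation[OF adm p(1,2) pc(1) far]
  note c = action_integrand_continuous[OF adm]
  note c' = action_integrand_continuous[OF adm', unfolded chord_add_scaleR]
  have split: "action \<alpha> g g' = integral {0..2*pi} (\<lambda>t. (norm (g' t))\<^sup>2 / 2) + integral {0..2*pi} (\<lambda>t. norm (chord g t) powr (- \<alpha>))"
    if "admissible g g'" for g g'
    unfolding action_def
    by (rule Henstock_Kurzweil_Integration.integral_add; intro continuous_integrable action_integrand_continuous[OF that])
  have pp: "period (2*pi) p" "period (2*pi) p'"
    using eight_symmetric_period[OF p(1)] period_deriv[OF p(2)] by auto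
  have "integral {0..2*pi} (\<lambda>t. f' t \<bullet> p' t) = - integral {0..2*pi} (\<lambda>t. f t \<bullet> p'' t)"
    by (rule integral_by_parts_period) (auto intro!: a p pp)
  moreover have "integral {0..2*pi} (\<lambda>t. (norm (f' t + e *\<^sub>R p' t))\<^sup>2 / 2)
    = integral {0..2*pi} (\<lambda>t. (norm (f' t))\<^sup>2 / 2) + e * integral {0..2*pi} (\<lambda>t. f' t \<bullet> p' t)
      + e\<^sup>2 * integral {0..2*pi} (\<lambda>t. (norm (p' t))\<^sup>2 / 2)"
  proof -
    have "(norm (f' t + e *\<^sub>R p' t))\<^sup>2 / 2 = (norm (f' t))\<^sup>2 / 2 + e * (f' t \<bullet> p' t) + e\<^sup>2 * ((norm (p' t))\<^sup>2 / 2)" for t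
      unfolding power2_norm_eq_inner
      by (simp add: inner_add_left inner_add_right inner_commute[of "p' t" "f' t"] power2_eq_square field_simps)
    then have eq: "(\<lambda>t. (norm (f' t + e *\<^sub>R p' t))\<^sup>2 / 2)
      = (\<lambda>t. (norm (f' t))\<^sup>2 / 2 + e * (f' t \<bullet> p' t) + e\<^sup>2 * ((norm (p' t))\<^sup>2 / 2))" by blast
    have I: "((\<lambda>t. (norm (f' t))\<^sup>2 / 2) has_integral integral {0..2*pi} (\<lambda>t. (norm (f' t))\<^sup>2 / 2)) {0..2*pi}"
      "((\<lambda>t. f' t \<bullet> p' t) has_integral integral {0..2*pi} (\<lambda>t. f' t \<bullet> p' t)) {0..2*pi}"
      "((\<lambda>t. (norm (p' t))\<^sup>2 / 2) has_integral integral {0..2*pi} (\<lambda>t. (norm (p' t))\<^sup>2 / 2)) {0..2*pi}"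
      by (intro integrable_integral continuous_integrable continuous_intros a pc; simp)+
    show ?thesis unfolding eq
      by (rule integral_unique) (intro has_integral_add has_integral_mult_right I)
  qed
  ultimately show ?thesis
    unfolding split[OF adm] split[OF adm'] chord_add_scaleR by (simp add: field_simps)
qed

lemma integral_powr_norm_chord_tendsto:
  fixes g :: "nat \<Rightarrow> real \<Rightarrow> 'a::euclidean_space"
  assumes conv: "\<And>t. (\<lambda>n. g n t) \<longlonglongrightarrow> h t" and gc: "\<And>n. continuous_on UNIV (g n)"
    and d: "0 < d" "\<And>n t. d \<le> norm (g n t)" and "0 < \<alpha>"
  shows "(\<lambda>n. integral {a..b} (\<lambda>t. norm (g n t) powr (- \<alpha>))) \<longlonglongrightarrow> integral {a..b} (\<lambda>t. norm (h t) powr (- \<alpha>))"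
proof (rule dominated_convergence(2)[where h = "\<lambda>t. d powr (- \<alpha>)"])
  fix n
  have nz: "norm (g n t) \<noteq> 0" for t using d(1) d(2)[of n t] by linarith
  show "(\<lambda>t. norm (g n t) powr (- \<alpha>)) integrable_on {a..b}"
    by (intro continuous_integrable continuous_intros gc) (use nz in auto)
  show "norm (norm (g n t) powr (- \<alpha>)) \<le> d powr (- \<alpha>)" for t
    using d \<open>0 < \<alpha>\<close> by (auto intro!: powr_mono2')
next
  fix t
  have "d \<le> norm (h t)" by (rule LIMSEQ_le_const[OF tendsto_norm[OF conv]]) (use d in auto)
  then have "norm (h t) \<noteq> 0" using d(1) by linarith
  then show "(\<lambda>n. norm (g n t) powr (- \<alpha>)) \<longlonglongrightarrow> norm (h t) powr (- \<alpha>)"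
    by (intro tendsto_intros conv) auto
qed (rule integrable_const_ivl)

text \<open>The limit of a minimizing sequence need not be known to be differentiable for this: the
  variation of the kinetic term is moved onto the test function before passing to the limit.\<close>

lemma exists_weak_solution:
  assumes \<alpha>: "0 < \<alpha>" "\<alpha> < 2"
  obtains g where "continuous_on UNIV g" "eight_symmetric g" "\<And>t. chord g t \<noteq> 0"
    "\<And>p p' p''. eight_symmetric p \<Longrightarrow> (\<And>t. (p has_vector_derivative p' t) (at t)) \<Longrightarrow>
      (\<And>t. (p' has_vector_derivative p'' t) (at t)) \<Longrightarrow> continuous_on UNIV p'' \<Longrightarrow>
      integral {0..2*pi} (\<lambda>t. g t \<bullet> p'' t) =
      integral {0..2*pi} (\<lambda>t. (- \<alpha> * norm (chord g t) powr (- \<alpha> - 2)) *\<^sub>R chord g t \<bullet> chord p t)"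
proof -
  obtain \<Lambda> \<delta> f\<^sub>0 f\<^sub>0' where \<delta>: "0 < \<delta>" and f0: "admissible f\<^sub>0 f\<^sub>0'" "action \<alpha> f\<^sub>0 f\<^sub>0' < \<Lambda>"
    and far: "\<forall>f f' t. admissible f f' \<longrightarrow> action \<alpha> f f' < \<Lambda> \<longrightarrow> \<delta> \<le> norm (chord f t)"
    by (rule chord_bounded_below[OF \<alpha>])
  define S where "S = {action \<alpha> f f' | f f'. admissible f f'}"
  define I where "I = Inf S"
  have S: "bdd_below S" "S \<noteq> {}"
    using action_nonneg f0(1) by (auto simp: S_def intro!: bdd_belowI[of _ 0])
  have I: "I \<le> action \<alpha> f f'" if "admissible f f'" for f f'
    unfolding I_def by (rule cInf_lower[OF _ S(1)]) (use that in \<open>auto simp: S_def\<close>)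
  have I\<Lambda>: "I < \<Lambda>" using I[OF f0(1)] f0(2) by simp
  have "\<exists>f f'. admissible f f' \<and> action \<alpha> f f' < min \<Lambda> (I + 1 / real (Suc n))" for n
  proof -
    have "Inf S < min \<Lambda> (I + 1 / real (Suc n))" using I\<Lambda> by (simp add: I_def)
    then obtain y where "y \<in> S" "y < min \<Lambda> (I + 1 / real (Suc n))" using cInf_lessD[OF S(2)] by blast
    then show ?thesis unfolding S_def by blast
  qed
  then obtain f f' where adm: "\<And>n. admissible (f n) (f' n)"
    and act: "\<And>n. action \<alpha> (f n) (f' n) < min \<Lambda> (I + 1 / real (Suc n))" by metis
  have act\<Lambda>: "action \<alpha> (f n) (f' n) \<le> \<Lambda>" for n using act[of n] by simp
  obtain k g M where k: "strict_mono (k :: nat \<Rightarrow> nat)"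
    and convM: "\<forall>t. (\<lambda>n. f (k n) t) \<longlonglongrightarrow> g t" and gc: "continuous_on UNIV g" and gs: "eight_symmetric g"
    and bM: "\<forall>n t. norm (f n t) \<le> M"
    by (rule admissible_compactness[of f f' \<alpha> \<Lambda>, OF adm act\<Lambda>])
  note conv = convM[rule_format] and M = bM[rule_format]
  have farn: "\<delta> \<le> norm (chord (f n) t)" for n t using far adm act[of n] by auto
  have cconv: "(\<lambda>n. chord (f (k n)) t) \<longlonglongrightarrow> chord g t" for t
    unfolding chord_def by (intro tendsto_diff conv)
  have fc: "continuous_on UNIV (f n)" for n by (rule admissibleD[OF adm])
  have farg: "\<delta> \<le> norm (chord g t)" for t
    by (rule LIMSEQ_le_const[OF tendsto_norm[OF cconv]]) (use farn in auto)
  have nz: "chord g t \<noteq> 0" for t using farg[of t] \<delta> by auto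
  have weak: "integral {0..2*pi} (\<lambda>t. g t \<bullet> p'' t) =
      integral {0..2*pi} (\<lambda>t. (- \<alpha> * norm (chord g t) powr (- \<alpha> - 2)) *\<^sub>R chord g t \<bullet> chord p t)"
    if p: "eight_symmetric p" "\<And>t. (p has_vector_derivative p' t) (at t)"
      "\<And>t. (p' has_vector_derivative p'' t) (at t)" "continuous_on UNIV p''" for p p' p''
  proof -
    have pc: "continuous_on UNIV p'" "continuous_on UNIV p"
      using continuous_on_of_derivative[OF p(3)] continuous_on_of_derivative[OF p(2)] .
    obtain B where B: "\<And>t. norm (chord p t) \<le> B" "0 < B"
      using period_bounded[OF continuous_chord[OF pc(2)] period_chord[OF eight_symmetric_period[OF p(1)]]] by auto
    have "compact (p'' ` {0..2*pi})"
      using p(4) by (intro compact_continuous_image) (auto intro: continuous_on_subset)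
    then obtain C where C: "\<forall>t\<in>{0..2*pi}. norm (p'' t) \<le> C"
      by (auto dest!: compact_imp_bounded simp: bounded_iff)
    \<comment> \<open>A perturbation with parameter up to \<open>r\<close> moves the chord by at
      most \<open>\<delta> / 2\<close>, half its distance from collision.\<close>
    define r where "r = \<delta> / (2 * B)"
    have r: "0 < r" using \<delta> B by (simp add: r_def)
    have away: "\<delta> / 2 \<le> norm (u + e *\<^sub>R chord p t)" if "\<delta> \<le> norm u" "\<bar>e\<bar> \<le> r" for u e t
    proof -
      have "norm (e *\<^sub>R chord p t) \<le> r * B"
        unfolding norm_scaleR using that(2) B r by (intro mult_mono) auto
      also have "\<dots> = \<delta> / 2" using B by (simp add: r_def)
      finally show ?thesis using that(1) norm_diff_ineq[of u "e *\<^sub>R chord p t"] by linarith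
    qed
    define W where "W e = integral {0..2*pi} (\<lambda>t. norm (chord g t + e *\<^sub>R chord p t) powr (- \<alpha>))" for e
    define A where "A = integral {0..2*pi} (\<lambda>t. g t \<bullet> p'' t)"
    define E where "E = integral {0..2*pi} (\<lambda>t. (norm (p' t))\<^sup>2 / 2)"
    \<comment> \<open>For fixed \<open>e\<close> the near-minimality of \<open>f (k n)\<close> is
      passed to the limit; no action of \<open>g\<close> itself is evaluated.\<close>
    have pos: "0 \<le> - e * A + e\<^sup>2 * E + W e - W 0" if e: "\<bar>e\<bar> \<le> r" for e
    proof -
      have nzn: "chord (f n) t + e *\<^sub>R chord p t \<noteq> 0" for n t
        using away[OF farn e, of n t t] \<delta> by auto
      have low: "- (1 / real (Suc n)) \<le> - e * integral {0..2*pi} (\<lambda>t. f (k n) t \<bullet> p'' t) + e\<^sup>2 * E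
          + integral {0..2*pi} (\<lambda>t. norm (chord (f (k n)) t + e *\<^sub>R chord p t) powr (- \<alpha>))
          - integral {0..2*pi} (\<lambda>t. norm (chord (f (k n)) t) powr (- \<alpha>))" for n
      proof -
        have "I \<le> action \<alpha> (\<lambda>t. f (k n) t + e *\<^sub>R p t) (\<lambda>t. f' (k n) t + e *\<^sub>R p' t)"
          by (rule I[OF admissible_variation[OF adm p(1,2) pc(1) nzn]])
        moreover have "action \<alpha> (f (k n)) (f' (k n)) \<le> I + 1 / real (Suc n)"
        proof -
          \<comment> \<open>A strictly increasing \<open>k\<close> satisfies
            \<open>n \<le> k n\<close>.\<close>
          have "1 / real (Suc (k n)) \<le> 1 / real (Suc n)"
            using seq_suble[OF k, of n] by (intro divide_left_mono) auto
          then show ?thesis using act[of "k n"] by simp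
        qed
        ultimately show ?thesis
          using action_variation[where \<alpha> = \<alpha>, OF adm[of "k n"] p nzn] by (simp add: E_def)
      qed
      have "(\<lambda>n. integral {0..2*pi} (\<lambda>t. f (k n) t \<bullet> p'' t)) \<longlonglongrightarrow> A"
        unfolding A_def
      proof (rule dominated_convergence(2)[where h = "\<lambda>t. M * C"])
        show "(\<lambda>t. f (k n) t \<bullet> p'' t) integrable_on {0..2*pi}" for n
          by (intro continuous_integrable continuous_intros fc p)
        show "norm (f (k n) t \<bullet> p'' t) \<le> M * C" if "t \<in> {0..2*pi}" for n t
        proof -
          have "norm (f (k n) t \<bullet> p'' t) \<le> norm (f (k n) t) * norm (p'' t)"
            using Cauchy_Schwarz_ineq2 by simp
          also have "\<dots> \<le> M * C"
            using M C that order_trans[OF norm_ge_zero M] by (intro mult_mono) auto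
          finally show ?thesis .
        qed
        show "(\<lambda>n. f (k n) t \<bullet> p'' t) \<longlonglongrightarrow> g t \<bullet> p'' t" for t
          by (intro tendsto_intros conv)
      qed (rule integrable_const_ivl)
      moreover have "(\<lambda>n. integral {0..2*pi} (\<lambda>t. norm (chord (f (k n)) t + e *\<^sub>R chord p t) powr (- \<alpha>))) \<longlonglongrightarrow> W e"
        unfolding W_def
        by (rule integral_powr_norm_chord_tendsto[where d = "\<delta> / 2"])
          (use \<delta> \<alpha> away[OF farn e] in \<open>auto intro!: tendsto_intros cconv continuous_intros continuous_chord fc pc\<close>)
      moreover have "(\<lambda>n. integral {0..2*pi} (\<lambda>t. norm (chord (f (k n)) t) powr (- \<alpha>))) \<longlonglongrightarrow> W 0"
        unfolding W_def using integral_powr_norm_chord_tendsto[OF cconv continuous_chord[OF fc] \<delta> farn \<alpha>(1), where a = 0 and b = "2*pi"]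
        by simp
      ultimately have "(\<lambda>n. - e * integral {0..2*pi} (\<lambda>t. f (k n) t \<bullet> p'' t) + e\<^sup>2 * E
          + integral {0..2*pi} (\<lambda>t. norm (chord (f (k n)) t + e *\<^sub>R chord p t) powr (- \<alpha>))
          - integral {0..2*pi} (\<lambda>t. norm (chord (f (k n)) t) powr (- \<alpha>))) \<longlonglongrightarrow> - e * A + e\<^sup>2 * E + W e - W 0"
        by (intro tendsto_intros)
      moreover have "(\<lambda>n. - (1 / real (Suc n))) \<longlonglongrightarrow> 0"
        using tendsto_minus[OF LIMSEQ_inverse_real_of_nat] by (simp add: inverse_eq_divide)
      ultimately show ?thesis using low by (intro LIMSEQ_le) auto
    qed
    define W' where "W' = integral {0..2*pi} (\<lambda>t. (- \<alpha> * norm (chord g t) powr (- \<alpha> - 2)) *\<^sub>R chord g t \<bullet> chord p t)"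
    have cont: "continuous_on ({- r..r} \<times> {0..2*pi}) (\<lambda>z. chord g (snd z) + fst z *\<^sub>R chord p (snd z))"
      by (intro continuous_intros continuous_on_compose2[OF continuous_chord[OF gc]]
          continuous_on_compose2[OF continuous_chord[OF pc(2)]]) auto
    have nzg: "chord g t + e *\<^sub>R chord p t \<noteq> 0" if "e \<in> {- r..r}" for e t
    proof -
      have "\<bar>e\<bar> \<le> r" using that by auto
      from away[OF farg this, of t t] \<delta> show ?thesis by auto
    qed
    \<comment> \<open>Differentiation under the integral is justified on \<open>[- r, r]\<close>,
      where the perturbed chord never vanishes.\<close>
    have "((\<lambda>e. integral (cbox 0 (2*pi)) (\<lambda>t. norm (chord g t + e *\<^sub>R chord p t) powr (- \<alpha>))) has_field_derivative
        integral (cbox 0 (2*pi)) (\<lambda>t. - \<alpha> * norm (chord g t + 0 *\<^sub>R chord p t) powr (- \<alpha> - 2) *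
          ((chord g t + 0 *\<^sub>R chord p t) \<bullet> chord p t))) (at 0 within {- r..r})"
    proof (rule leibniz_rule_field_derivative)
      fix e t assume e: "e \<in> {- r..r}"
      show "((\<lambda>e. norm (chord g t + e *\<^sub>R chord p t) powr (- \<alpha>)) has_field_derivative
          - \<alpha> * norm (chord g t + e *\<^sub>R chord p t) powr (- \<alpha> - 2) *
          ((chord g t + e *\<^sub>R chord p t) \<bullet> chord p t)) (at e within {- r..r})"
        by (rule powr_norm_line_derivative[OF nzg[OF e]])
    next
      fix e assume e: "e \<in> {- r..r}"
      show "(\<lambda>t. norm (chord g t + e *\<^sub>R chord p t) powr (- \<alpha>)) integrable_on cbox 0 (2*pi)"
        unfolding box_real
        by (intro continuous_integrable continuous_intros continuous_chord gc pc) (use nzg[OF e] in auto)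
    next
      show "continuous_on ({- r..r} \<times> cbox 0 (2*pi)) (\<lambda>(e, t). - \<alpha> * norm (chord g t + e *\<^sub>R chord p t) powr (- \<alpha> - 2) *
          ((chord g t + e *\<^sub>R chord p t) \<bullet> chord p t))"
        unfolding box_real split_beta
        by (intro continuous_intros cont continuous_on_compose2[OF continuous_chord[OF pc(2)]]) (use nzg in auto)
    qed (use r in auto)
    then have "(W has_field_derivative W') (at 0 within {- r..r})"
      unfolding W_def[abs_def] W'_def box_real by (simp add: mult.assoc)
    then have WD: "(W has_field_derivative W') (at 0)" using r by (simp add: at_within_Icc_at)
    have "((\<lambda>e. - e * A + e\<^sup>2 * E + W e - W 0) has_field_derivative (- A + W')) (at 0)"
      using WD by (auto intro!: derivative_eq_intros)
    \<comment> \<open>By \<open>pos\<close> the function is nonnegative near 0 and takes the value 0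
      there, so its slope vanishes.\<close>
    then have "- A + W' = 0"
      by (rule DERIV_local_min[OF _ r]) (use pos in auto)
    then show ?thesis by (simp add: A_def W'_def)
  qed
  show thesis by (rule that[OF gc gs nz weak])
qed

section \<open>Newton's equation\<close>

lemma antiderivative_UNIV:
  fixes f :: "real \<Rightarrow> 'a::euclidean_space"
  assumes f: "continuous_on UNIV f"
  obtains g where "\<And>t. (g has_vector_derivative f t) (at t)" "g 0 = 0"
proof -
  \<comment> \<open>An integral over \<open>{a..b}\<close> with \<open>b < a\<close> is 0, so the
    difference is the oriented integral from 0 to \<open>t\<close>.\<close>
  define g where "g t = integral {0..t} f - integral {t..0} f" for t
  have "(g has_vector_derivative f t) (at t)" for t
  proof -
  define a where "a = \<bar>t\<bar> + 1"
  have t: "t \<in> {- a<..<a}" by (auto simp: a_def)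
  have "((\<lambda>x. integral {- a..x} f) has_vector_derivative f t) (at t within {- a..a})"
    by (rule integral_has_vector_derivative) (use f t in \<open>auto intro: continuous_on_subset\<close>)
  then have "((\<lambda>x. integral {- a..x} f) has_vector_derivative f t) (at t)"
    using t by (simp add: at_within_Icc_at)
  then have "((\<lambda>x. integral {- a..x} f - integral {- a..0} f) has_vector_derivative f t) (at t)"
    by (intro derivative_eq_intros) auto
  then show "(g has_vector_derivative f t) (at t)"
  proof (rule has_vector_derivative_transform_within_open[where g = g, OF _ open_greaterThanLessThan t])
    fix x assume x: "x \<in> {- a<..<a}"
    show "integral {- a..x} f - integral {- a..0} f = g x"
    proof (cases "0 \<le> x")
      case True
      then have "integral {- a..0} f + integral {0..x} f = integral {- a..x} f"
        using f t by (intro Henstock_Kurzweil_Integration.integral_combine) auto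
      then show ?thesis using True by (cases "x = 0") (auto simp: g_def algebra_simps)
    next
      case False
      then have "integral {- a..x} f + integral {x..0} f = integral {- a..0} f"
        using f x by (intro Henstock_Kurzweil_Integration.integral_combine) auto
      then show ?thesis using False by (auto simp: g_def algebra_simps)
    qed
  qed
  qed
  then show thesis using that[of g] by (simp add: g_def)
qed

lemma bounded_affine_const:
  fixes h :: "real \<Rightarrow> 'a::real_normed_vector"
  assumes h: "\<And>t. (h has_vector_derivative h' t) (at t)" "\<And>t. (h' has_vector_derivative 0) (at t)"
    and B: "\<And>t. norm (h t) \<le> B"
  shows "h s = h t"
proof -
  define c where "c = h' 0"
  have c: "h' t = c" for t using vector_derivative_zero_const[OF h(2), of t 0] by (simp add: c_def)
  have d: "((\<lambda>t. h t - t *\<^sub>R c) has_vector_derivative 0) (at t)" for t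
    using h(1)[of t] by (auto intro!: derivative_eq_intros simp: c)
  have aff: "h t = h 0 + t *\<^sub>R c" for t
    using vector_derivative_zero_const[OF d, of t 0] unfolding diff_eq_eq by simp
  have "c = 0"
  proof (rule ccontr)
    assume "c \<noteq> 0"
    \<comment> \<open>At this time the linear part has norm \<open>2 * B + 1\<close>, more than two
      values bounded by \<open>B\<close> can differ.\<close>
    define t where "t = (2 * B + 1) / norm c"
    have "0 \<le> B" using norm_ge_zero[of "h 0"] B[of 0] by linarith
    then have "norm (t *\<^sub>R c) = 2 * B + 1" using \<open>c \<noteq> 0\<close> by (simp add: t_def)
    moreover have "norm (t *\<^sub>R c) \<le> norm (h t) + norm (h 0)"
    proof -
      have "t *\<^sub>R c = h t - h 0" unfolding aff[of t] by simp
      then show ?thesis by (simp only: norm_triangle_ineq4)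
    qed
    ultimately show False using B[of t] B[of 0] by linarith
  qed
  then show ?thesis unfolding aff[of s] aff[of t] by simp
qed

text \<open>\<open>F\<close> is integrated twice; the constants of integration are fixed by oddness and periodicity.\<close>

lemma eight_symmetric_double_primitive:
  fixes F :: "real \<Rightarrow> real ^ 2"
  assumes F: "continuous_on UNIV F" and sym: "eight_symmetric F"
  obtains G G' where "eight_symmetric G"
    "\<And>t. (G has_vector_derivative G' t) (at t)" "\<And>t. (G' has_vector_derivative F t) (at t)"
proof -
  note s = eight_symmetricD[OF sym]
  obtain H where H: "\<And>t. (H has_vector_derivative F t) (at t)" "H 0 = 0"
    using antiderivative_UNIV[OF F] by blast
  have Hev: "H (- t) = H t" for t
  proof -
    have "((\<lambda>t. H (- t) - H t) has_vector_derivative 0) (at t)" for t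
      using has_vector_derivative_diff[OF has_vector_derivative_minus_arg[OF H(1)] H(1), of t]
      by (simp add: s(2))
    from vector_derivative_zero_const[OF this, of t 0] show ?thesis by simp
  qed
  have Hper: "H (t + 2*pi) = H t" for t
  proof -
    have "((\<lambda>t. H (t + 2*pi) - H t) has_vector_derivative 0) (at t)" for t
      using has_vector_derivative_diff[OF has_vector_derivative_shift_arg[OF H(1)] H(1), of "2*pi" t]
      by (simp add: s(3))
    \<comment> \<open>At \<open>- pi\<close> the difference is \<open>H pi - H (- pi)\<close>, which
      vanishes because \<open>H\<close> is even.\<close>
    from vector_derivative_zero_const[OF this, of t "- pi"] show ?thesis by (simp add: Hev)
  qed
  have Hc: "continuous_on UNIV H" using H(1) by (rule continuous_on_of_derivative)
  obtain K where K: "\<And>t. (K has_vector_derivative H t) (at t)" "K 0 = 0"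
    using antiderivative_UNIV[OF Hc] by blast
  have Kodd: "K (- t) = - K t" for t
  proof -
    have "((\<lambda>t. K (- t) + K t) has_vector_derivative 0) (at t)" for t
      using has_vector_derivative_add[OF has_vector_derivative_minus_arg[OF K(1)] K(1), of t]
      by (simp add: Hev)
    from vector_derivative_zero_const[OF this, of t 0] show ?thesis by (simp add: K(2) eq_neg_iff_add_eq_0)
  qed
  \<comment> \<open>The mean slope of \<open>K\<close>; removing this drift makes the primitive
    periodic and keeps it odd.\<close>
  define c where "c = (1 / (2*pi)) *\<^sub>R K (2*pi)"
  have Kper: "K (t + 2*pi) = K t + (2*pi) *\<^sub>R c" for t
  proof -
    have "((\<lambda>t. K (t + 2*pi) - K t) has_vector_derivative 0) (at t)" for t
      using has_vector_derivative_diff[OF has_vector_derivative_shift_arg[OF K(1)] K(1), of "2*pi" t]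
      by (simp add: Hper)
    from vector_derivative_zero_const[OF this, of t 0] show ?thesis by (simp add: K(2) c_def algebra_simps)
  qed
  define G G' where "G t = K t - t *\<^sub>R c" and "G' t = H t - c" for t
  have G: "(G has_vector_derivative G' t) (at t)" for t
    unfolding G_def G'_def using K(1)[of t] by (auto intro!: derivative_eq_intros)
  have G': "(G' has_vector_derivative F t) (at t)" for t
    unfolding G'_def using H(1)[of t] by (auto intro!: derivative_eq_intros)
  have Godd: "G (- t) = - G t" for t by (simp add: G_def Kodd)
  have Gper: "period (2*pi) G" unfolding period_def G_def Kper by (simp add: scaleR_add_left)
  have Gc: "continuous_on UNIV G" using G by (rule continuous_on_of_derivative)
  obtain B where B: "\<And>t. norm (G t) \<le> B" using period_bounded[OF Gc Gper] pi_gt_zero by auto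
  \<comment> \<open>The defect in the half-period symmetry. It is bounded with zero second
    derivative, hence constant; its values at 0, \<open>pi\<close> and \<open>- pi\<close> force it
    to vanish.\<close>
  define E where "E t = G (t + pi) - mirror (G t)" for t
  have rd: "((\<lambda>t. mirror (f t)) has_vector_derivative mirror (f' t)) (at t)"
    if "\<And>t. (f has_vector_derivative f' t) (at t)" for f f' t
    using bounded_linear.has_vector_derivative[OF bounded_linear_mirror that] .
  have Econst: "E t = E u" for t u
  proof (rule bounded_affine_const)
    show "(E has_vector_derivative G' (t + pi) - mirror (G' t)) (at t)" for t
      unfolding E_def by (intro has_vector_derivative_diff has_vector_derivative_shift_arg rd G)
    have "((\<lambda>t. G' (t + pi) - mirror (G' t)) has_vector_derivative F (t + pi) - mirror (F t)) (at t)" for t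
      by (intro has_vector_derivative_diff has_vector_derivative_shift_arg rd G')
    then show "((\<lambda>t. G' (t + pi) - mirror (G' t)) has_vector_derivative 0) (at t)" for t
      by (simp add: s(1))
    show "norm (E t) \<le> B + B" for t
      unfolding E_def using norm_triangle_ineq4[of "G (t + pi)" "mirror (G t)"] B[of "t + pi"] B[of t] by simp
  qed
  have "G 0 = 0" by (simp add: G_def K(2))
  then have "E 0 = G pi" "E (- pi) = mirror (G pi)" by (simp_all add: E_def Godd)
  moreover have "E pi = - mirror (G pi)"
    using Gper[unfolded period_def, rule_format, of 0] \<open>G 0 = 0\<close> by (simp add: E_def)
  ultimately have "mirror (G pi) = - mirror (G pi)" using Econst by metis
  then have "2 *\<^sub>R mirror (G pi) = 0" by (simp add: scaleR_2)
  then have "E 0 = 0" using \<open>E 0 = G pi\<close> \<open>E (- pi) = mirror (G pi)\<close> Econst[of 0 "- pi"] by simp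
  then have "G (t + pi) = mirror (G t)" for t using Econst[of t 0] by (simp add: E_def)
  then have "eight_symmetric G" by (simp add: eight_symmetric_def Godd)
  then show thesis using that G G' by blast
qed

section \<open>The force along a loop and the regularity of the limit\<close>

definition pair_force :: "real \<Rightarrow> real ^ 2 \<Rightarrow> real ^ 2 \<Rightarrow> real ^ 2" where
  "pair_force \<alpha> a b = (- \<alpha> * norm (a - b) powr (- \<alpha> - 2)) *\<^sub>R (a - b)"

text \<open>The third body is placed at \<open>t - 2*pi/3\<close>, the same as
  \<open>t + 4*pi/3\<close> on a periodic loop, so that reversing time swaps the two terms.\<close>

definition loop_force :: "real \<Rightarrow> (real \<Rightarrow> real ^ 2) \<Rightarrow> real \<Rightarrow> real ^ 2" where
  "loop_force \<alpha> g t = pair_force \<alpha> (g t) (g (t + 2*pi/3)) + pair_force \<alpha> (g t) (g (t - 2*pi/3))"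

lemma pair_force_swap: "pair_force \<alpha> b a = - pair_force \<alpha> a b"
  by (simp add: pair_force_def norm_minus_commute[of b a] scaleR_diff_right)

lemma pair_force_minus: "pair_force \<alpha> (- a) (- b) = - pair_force \<alpha> a b"
proof -
  have "- a - - b = - (a - b)" by simp
  then show ?thesis unfolding pair_force_def by (simp only: norm_minus_cancel scaleR_minus_right)
qed

lemma pair_force_mirror: "pair_force \<alpha> (mirror a) (mirror b) = mirror (pair_force \<alpha> a b)"
proof -
  have "mirror a - mirror b = mirror (a - b)" by simp
  then show ?thesis unfolding pair_force_def by (simp only: norm_mirror mirror_linear(5))
qed

lemma eight_symmetric_loop_force:
  assumes "eight_symmetric g"
  shows "eight_symmetric (loop_force \<alpha> g)"
  unfolding eight_symmetric_def
proof (intro allI conjI)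
  fix t
  note s = eight_symmetricD[OF assms]
  have "g (t + pi + 2*pi/3) = mirror (g (t + 2*pi/3))" "g (t + pi - 2*pi/3) = mirror (g (t - 2*pi/3))"
    using s(1)[of "t + 2*pi/3"] s(1)[of "t - 2*pi/3"] by (simp_all add: algebra_simps)
  then show "loop_force \<alpha> g (t + pi) = mirror (loop_force \<alpha> g t)"
    by (simp add: loop_force_def s(1) pair_force_mirror)
  have "g (- t + 2*pi/3) = - g (t - 2*pi/3)" "g (- t - 2*pi/3) = - g (t + 2*pi/3)"
    using s(2)[of "t - 2*pi/3"] s(2)[of "t + 2*pi/3"] by simp_all
  then show "loop_force \<alpha> g (- t) = - loop_force \<alpha> g t"
    by (simp add: loop_force_def s(2) pair_force_minus)
qed

lemma exists_newton_loop:
  assumes \<alpha>: "0 < \<alpha>" "\<alpha> < 2"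
  obtains g g' where "eight_symmetric g" "\<And>t. chord g t \<noteq> 0"
    "\<And>t. (g has_vector_derivative g' t) (at t)" "\<And>t. (g' has_vector_derivative loop_force \<alpha> g t) (at t)"
proof (rule exists_weak_solution[OF \<alpha>])
  fix g assume gc: "continuous_on UNIV g" and gs: "eight_symmetric g" and nz: "\<And>t. chord g t \<noteq> 0"
    and weak: "\<And>p p' p''. eight_symmetric p \<Longrightarrow> (\<And>t. (p has_vector_derivative p' t) (at t)) \<Longrightarrow>
      (\<And>t. (p' has_vector_derivative p'' t) (at t)) \<Longrightarrow> continuous_on UNIV p'' \<Longrightarrow>
      integral {0..2*pi} (\<lambda>t. g t \<bullet> p'' t) =
      integral {0..2*pi} (\<lambda>t. (- \<alpha> * norm (chord g t) powr (- \<alpha> - 2)) *\<^sub>R chord g t \<bullet> chord p t)"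
  \<comment> \<open>The force from the next body, which is what the weak equation contains. As pair
    forces are opposite, the total force is its backward difference.\<close>
  define c where "c t = pair_force \<alpha> (g t) (g (t + 2*pi/3))" for t
  define F where "F = loop_force \<alpha> g"
  have c_eq: "c = (\<lambda>t. (- \<alpha> * norm (chord g t) powr (- \<alpha> - 2)) *\<^sub>R chord g t)"
    by (simp add: fun_eq_iff c_def pair_force_def chord_def)
  have cc: "continuous_on UNIV c"
    unfolding c_eq by (intro continuous_intros continuous_chord gc) (simp add: nz)
  have gp: "period (2*pi) g" by (rule eight_symmetric_period[OF gs])
  have cp: "period (2*pi) c"
    using gp period_shift[OF gp, of "2*pi/3"] by (simp add: period_def c_def)
  have F_eq: "F t = c t - c (t - 2*pi/3)" for t
    by (simp add: F_def loop_force_def c_def pair_force_swap[of \<alpha> "g t" "g (t - 2*pi/3)"])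
  have Fc: "continuous_on UNIV F"
    unfolding F_eq[abs_def] using continuous_on_shift[OF cc, of UNIV "- (2*pi/3)"] cc
    by (auto intro!: continuous_intros)
  have Fs: "eight_symmetric F" unfolding F_def by (rule eight_symmetric_loop_force[OF gs])
  obtain G G' where Gs: "eight_symmetric G" and G: "\<And>t. (G has_vector_derivative G' t) (at t)"
      "\<And>t. (G' has_vector_derivative F t) (at t)"
    using eight_symmetric_double_primitive[OF Fc Fs] by metis
  have Gc: "continuous_on UNIV G" "continuous_on UNIV G'"
    using continuous_on_of_derivative[OF G(1)] continuous_on_of_derivative[OF G(2)] .
  define d where "d t = g t - G t" for t
  have dc: "continuous_on UNIV d" unfolding d_def by (intro continuous_intros gc Gc)
  have ds: "eight_symmetric d" using gs Gs by (simp add: eight_symmetric_def d_def)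
  obtain p p' where ps: "eight_symmetric p" and p: "\<And>t. (p has_vector_derivative p' t) (at t)"
      "\<And>t. (p' has_vector_derivative d t) (at t)"
    using eight_symmetric_double_primitive[OF dc ds] by metis
  have pc: "continuous_on UNIV p" "continuous_on UNIV p'"
    using continuous_on_of_derivative[OF p(1)] continuous_on_of_derivative[OF p(2)] .
  note per = eight_symmetric_period[OF Gs] eight_symmetric_period[OF ps]
    period_deriv[OF G(1) eight_symmetric_period[OF Gs]] period_deriv[OF p(1) eight_symmetric_period[OF ps]]
  have "integral {0..2*pi} (\<lambda>t. g t \<bullet> d t) = integral {0..2*pi} (\<lambda>t. c t \<bullet> chord p t)"
    using weak[OF ps p dc] by (simp add: c_eq)
  also have "\<dots> = integral {0..2*pi} (\<lambda>t. c t \<bullet> p t) - integral {0..2*pi} (\<lambda>t. c t \<bullet> p (t + 2*pi/3))"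
    unfolding chord_def inner_diff_right
    by (intro Henstock_Kurzweil_Integration.integral_diff continuous_integrable continuous_intros
        continuous_on_shift cc pc)
  \<comment> \<open>A translation by a third of the period moves the difference from the test loop
    onto the force.\<close>
  also have "integral {0..2*pi} (\<lambda>t. c t \<bullet> p (t + 2*pi/3)) = integral {0..2*pi} (\<lambda>t. c (t - 2*pi/3) \<bullet> p t)"
  proof -
    define h where "h t = c (t + - (2*pi/3)) \<bullet> p t" for t
    have "continuous_on UNIV h" unfolding h_def by (intro continuous_intros continuous_on_shift cc pc)
    moreover have "period (2*pi) h"
      using period_shift[OF cp, of "- (2*pi/3)"] per(2) by (simp add: period_def h_def)
    ultimately have "integral {0..2*pi} (\<lambda>t. h (t + 2*pi/3)) = integral {0..2*pi} h"
      by (rule integral_period_shift(1)) simp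
    then show ?thesis by (simp add: h_def[abs_def])
  qed
  also have "integral {0..2*pi} (\<lambda>t. c t \<bullet> p t) - integral {0..2*pi} (\<lambda>t. c (t - 2*pi/3) \<bullet> p t)
      = integral {0..2*pi} (\<lambda>t. F t \<bullet> p t)"
    unfolding F_eq inner_diff_left
    using continuous_on_shift[OF cc, of UNIV "- (2*pi/3)"]
    by (intro Henstock_Kurzweil_Integration.integral_diff[symmetric] continuous_integrable continuous_intros cc pc) simp
  also have "\<dots> = - integral {0..2*pi} (\<lambda>t. G' t \<bullet> p' t)"
    by (rule integral_by_parts_period[OF G(2) Fc per(3) p(1) pc(2) per(2)]) simp
  also have "\<dots> = integral {0..2*pi} (\<lambda>t. G t \<bullet> d t)"
    using integral_by_parts_period[OF G(1) Gc(2) per(1) p(2) dc per(4)] by simp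
  finally have "integral {0..2*pi} (\<lambda>t. g t \<bullet> d t) - integral {0..2*pi} (\<lambda>t. G t \<bullet> d t) = 0" by simp
  moreover have "integral {0..2*pi} (\<lambda>t. d t \<bullet> d t)
      = integral {0..2*pi} (\<lambda>t. g t \<bullet> d t) - integral {0..2*pi} (\<lambda>t. G t \<bullet> d t)"
  proof -
    have "d t \<bullet> d t = g t \<bullet> d t - G t \<bullet> d t" for t by (subst (1) d_def) (rule inner_diff_left)
    then show ?thesis
      by (simp only:) (intro Henstock_Kurzweil_Integration.integral_diff continuous_integrable continuous_intros gc Gc dc)
  qed
  ultimately have "integral {0..2*pi} (\<lambda>t. d t \<bullet> d t) = 0" by simp
  moreover have "continuous_on {0..2*pi} (\<lambda>t. d t \<bullet> d t)"
    by (intro continuous_intros continuous_on_subset[OF dc]) auto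
  ultimately have d0: "\<forall>t\<in>{0..2*pi}. d t \<bullet> d t = 0" by (subst (asm) integral_eq_0_iff) auto
  have "d t = 0" for t
  proof -
    obtain s where "0 \<le> s" "s < 2*pi" "d t = d s"
      using period_reduce[OF eight_symmetric_period[OF ds], of t] by auto
    then show ?thesis using d0[rule_format, of s] by simp
  qed
  then have "g = G" by (simp add: d_def fun_eq_iff)
  then show thesis using that[OF gs nz, of G'] G by (simp add: F_def)
qed

section \<open>The gradient of the potential and the three-body solution\<close>

lemma GDERIV_powr_dist:
  fixes a b :: "real ^ 2"
  assumes "a \<noteq> b"
  shows "GDERIV (\<lambda>z. norm (z - b) powr (- \<alpha>)) a :> pair_force \<alpha> a b"
proof -
  have ns: "norm (z - b) powr r = ((z - b) \<bullet> (z - b)) powr (r / 2)" for z r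
  proof -
    have "(z - b) \<bullet> (z - b) = norm (z - b) powr 2" by (simp flip: power2_norm_eq_inner)
    then show ?thesis by (simp only: powr_powr) simp
  qed
  have pos: "0 < (a - b) \<bullet> (a - b)" using assms by simp
  have "GDERIV (\<lambda>z. (z - b) \<bullet> (z - b)) a :> 2 *\<^sub>R (a - b)"
    unfolding gderiv_def by (auto intro!: derivative_eq_intros simp: inner_commute)
  from GDERIV_DERIV_compose[OF this has_real_derivative_powr[OF pos, of "- \<alpha> / 2"]]
  have "GDERIV (\<lambda>z. ((z - b) \<bullet> (z - b)) powr (- \<alpha> / 2)) a :>
      (- \<alpha> / 2 * ((a - b) \<bullet> (a - b)) powr (- \<alpha> / 2 - 1)) *\<^sub>R 2 *\<^sub>R (a - b)" .
  moreover have e: "(- \<alpha> - 2) / 2 = - \<alpha> / 2 - 1" by simp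
  ultimately show ?thesis unfolding pair_force_def ns e by simp
qed

lemma potential_eq:
  "potential m \<alpha> q = m\<^sup>2 * (norm (q 0 - q 1) powr (- \<alpha>) + norm (q 0 - q 2) powr (- \<alpha>) + norm (q 1 - q 2) powr (- \<alpha>))"
proof -
  have "{..2} = {0, 1, 2::nat}" "{..<2} = {0, 1::nat}" by auto
  then show ?thesis by (simp add: potential_def algebra_simps)
qed

text \<open>Body \<open>i\<close> occurs in two of the three pairs, with its cyclic neighbours; the
  remaining pair is a constant.\<close>

lemma GDERIV_potential:
  assumes "i \<le> 2" "q 0 \<noteq> q 1" "q 0 \<noteq> q 2" "q 1 \<noteq> q 2"
  shows "GDERIV (\<lambda>z. potential m \<alpha> (q(i := z))) (q i) :>
    m\<^sup>2 *\<^sub>R (pair_force \<alpha> (q i) (q ((i + 1) mod 3)) + pair_force \<alpha> (q i) (q ((i + 2) mod 3)))"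
proof -
  have two: "GDERIV (\<lambda>z. m\<^sup>2 * (norm (z - b) powr (- \<alpha>) + norm (z - c) powr (- \<alpha>) + K)) a :>
      m\<^sup>2 *\<^sub>R (pair_force \<alpha> a b + pair_force \<alpha> a c)" if "a \<noteq> b" "a \<noteq> c" for a b c K
    using GDERIV_mult[OF GDERIV_const[of "m\<^sup>2" a] GDERIV_add[OF GDERIV_add[OF GDERIV_powr_dist[OF that(1)] GDERIV_powr_dist[OF that(2)]] GDERIV_const[of K a]]]
    by simp
  consider "i = 0" | "i = 1" | "i = 2" using assms(1) by linarith
  then show ?thesis
  proof cases
    case 1
    have "potential m \<alpha> (q(0 := z)) = m\<^sup>2 * (norm (z - q 1) powr (- \<alpha>) + norm (z - q 2) powr (- \<alpha>) + norm (q 1 - q 2) powr (- \<alpha>))" for z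
      by (simp add: potential_eq)
    then show ?thesis using two[of "q 0" "q 1" "q 2"] assms 1 by (simp add: numeral_2_eq_2)
  next
    case 2
    have "potential m \<alpha> (q(1 := z)) = m\<^sup>2 * (norm (z - q 2) powr (- \<alpha>) + norm (z - q 0) powr (- \<alpha>) + norm (q 0 - q 2) powr (- \<alpha>))" for z
      by (simp add: potential_eq norm_minus_commute)
    then show ?thesis using two[of "q 1" "q 2" "q 0"] assms 2 by (simp add: numeral_2_eq_2)
  next
    case 3
    have "potential m \<alpha> (q(2 := z)) = m\<^sup>2 * (norm (z - q 0) powr (- \<alpha>) + norm (z - q 1) powr (- \<alpha>) + norm (q 0 - q 1) powr (- \<alpha>))" for z
      by (simp add: potential_eq norm_minus_commute)
    then show ?thesis using two[of "q 2" "q 0" "q 1"] assms 3 by simp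
  qed
qed

lemma eight_symmetric_imp_H_eight:
  assumes g: "eight_symmetric g" "\<And>t. (g has_vector_derivative g' t) (at t)" "continuous_on UNIV g'"
  shows "g \<in> H_eight"
proof -
  note s = eight_symmetricD[OF g(1)]
  have "g \<in> H1_loops"
    unfolding H1_loops_def
  proof (intro CollectI conjI allI exI[of _ g'] ballI)
    show "g (t + 2*pi) = g t" for t by (rule s)
    have gc: "continuous_on {a..b} g'" for a b using g(3) continuous_on_subset by blast
    show "set_borel_measurable lborel {0..2*pi} g'"
      using borel_integrable_atLeastAtMost'[OF gc, of 0 "2*pi"] unfolding set_integrable_def set_borel_measurable_def
      by (rule borel_measurable_integrable)
    show "set_integrable lborel {0..2*pi} (\<lambda>s. (norm (g' s))\<^sup>2)"
      by (intro borel_integrable_atLeastAtMost' continuous_intros gc)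
    fix t :: real assume t: "t \<in> {0..2*pi}"
    have "(LINT s:{0..t}|lborel. g' s) = integral {0..t} g'"
      by (rule set_borel_integral_eq_integral(2)[OF borel_integrable_atLeastAtMost'[OF gc]])
    also have "\<dots> = g t - g 0"
    proof (rule integral_unique, rule fundamental_theorem_of_calculus)
      show "(g has_vector_derivative g' x) (at x within {0..t})" for x
        by (rule has_vector_derivative_at_within[OF g(2)])
    qed (use t in simp)
    finally show "g t = g 0 + (LINT s:{0..t}|lborel. g' s)" by simp
  qed
  moreover have "g (pi/2 + t) = vector [- (g (pi/2 - t) $ 1), g (pi/2 - t) $ 2]" for t
  proof -
    have "g (pi/2 + t) = g (- (pi/2 - t) + pi)" by (simp add: algebra_simps)
    also have "\<dots> = - mirror (g (pi/2 - t))" by (simp only: s(1) s(2) mirror_linear)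
    finally show ?thesis by (auto intro!: vec2_eqI)
  qed
  ultimately show ?thesis using s(1,4) by (simp add: H_eight_def mirror_def)
qed

theorem theorem6p4:
  fixes \<alpha> m :: real
  assumes "0 < \<alpha>" and "\<alpha> < 2" and "0 < m"
  shows "\<exists>\<gamma>. \<gamma> \<in> H_eight \<and>
           collision_free (choreography \<gamma>) \<and>
           (\<forall>k::int. \<gamma> (of_int k * pi) = 0) \<and>
           (\<exists>\<rho>>0. solves_newton m \<alpha> (\<lambda>i s. choreography \<gamma> i (s / sqrt \<rho>)))"
proof (rule exists_newton_loop[OF assms(1,2)])
  fix g g' assume gs: "eight_symmetric g" and nz: "\<And>t. chord g t \<noteq> 0"
    and g: "\<And>t. (g has_vector_derivative g' t) (at t)" "\<And>t. (g' has_vector_derivative loop_force \<alpha> g t) (at t)"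
  note s = eight_symmetricD[OF gs]
  have ne: "g t \<noteq> g (t + 2*pi/3)" for t using nz[of t] by (simp add: chord_def)
  have H: "g \<in> H_eight"
    by (rule eight_symmetric_imp_H_eight[OF gs g(1) continuous_on_of_derivative[OF g(2)]])
  define x where "x = choreography g"
  have x012: "x 0 t = g t" "x 1 t = g (t + 2*pi/3)" "x 2 t = g (t + 4*pi/3)" for t
    by (simp_all add: x_def choreography_def)
  \<comment> \<open>Three consecutive chords run around the triangle of the bodies and close up
    after one period.\<close>
  have ne3: "x 0 t \<noteq> x 1 t" "x 1 t \<noteq> x 2 t" "x 0 t \<noteq> x 2 t" for t
    using ne[of t] ne[of "t + 2*pi/3"] ne[of "t + 4*pi/3"] s(3)[of t]
    unfolding x012 by (simp_all add: add.assoc)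
  have "collision_free x"
    unfolding collision_free_def
  proof (intro allI impI)
    fix t and i j :: nat assume "i \<le> 2" "j \<le> 2" "i \<noteq> j"
    then have "i \<in> {0, 1, 2}" "j \<in> {0, 1, 2}" by auto
    then show "x i t \<noteq> x j t" using ne3[of t] \<open>i \<noteq> j\<close> by auto
  qed
  moreover have "g (of_int k * pi) = 0" for k :: int
  proof -
    \<comment> \<open>The half-period shift preserves the norm, so the zero at time 0 recurs at all
      multiples of \<open>pi\<close>.\<close>
    have "period pi (\<lambda>t. norm (g t))" by (simp add: period_def s(1))
    from period_int[OF this, of 0 k] show ?thesis by (simp add: s(4))
  qed
  \<comment> \<open>Speeding up time by \<open>sqrt m\<close> multiplies accelerations by
    \<open>m\<close>. Mass times acceleration is then \<open>m\<^sup>2\<close> times the loop force,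
    as the factor \<open>m\<^sup>2\<close> in the potential requires; hence
    \<open>\<rho> = 1/m\<close>.\<close>
  moreover have "solves_newton m \<alpha> (\<lambda>i s. x i (s / sqrt (1/m)))"
    unfolding solves_newton_def
  proof (intro exI allI impI conjI)
    fix i :: nat and t assume i: "i \<le> 2"
    define w where "w = sqrt m"
    have w: "w * w = m" "s / sqrt (1/m) = s * w" for s using assms(3) by (simp_all add: w_def real_sqrt_divide)
    have lin: "((\<lambda>s. s * w + c) has_vector_derivative w) (at t)" for c t
      by (auto intro!: derivative_eq_intros)
    have x_eq: "x i (s / sqrt (1/m)) = g (s * w + 2*pi*real i/3)" for i s
      by (simp add: x_def choreography_def w)
    show "((\<lambda>s. x i (s / sqrt (1/m))) has_vector_derivative (sqrt m *\<^sub>R g' (t * sqrt m + 2*pi*real i/3))) (at t)"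
      unfolding x_eq using vector_diff_chain_at[OF lin g(1)] by (simp add: o_def w_def)
    show "((\<lambda>t. sqrt m *\<^sub>R g' (t * sqrt m + 2*pi*real i/3)) has_vector_derivative
        (m *\<^sub>R loop_force \<alpha> g (t * sqrt m + 2*pi*real i/3))) (at t)"
      using bounded_linear.has_vector_derivative[OF bounded_linear_scaleR_right[of w] vector_diff_chain_at[OF lin g(2)]]
      using w(1) by (simp add: o_def w_def)
    define q where "q j = x j (t / sqrt (1/m))" for j
    have q: "q 0 \<noteq> q 1" "q 0 \<noteq> q 2" "q 1 \<noteq> q 2" using ne3 by (simp_all add: q_def)
    have "loop_force \<alpha> g (t * sqrt m + 2*pi*real i/3)
        = pair_force \<alpha> (q i) (q ((i + 1) mod 3)) + pair_force \<alpha> (q i) (q ((i + 2) mod 3))"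
    proof -
      define u where "u = t * w"
      have per: "g (u + 4*pi/3 + 2*pi/3) = g u" "g (u - 2*pi/3) = g (u + 4*pi/3)"
        using s(3)[of u] s(3)[of "u - 2*pi/3"] by (simp_all add: algebra_simps)
      have q_eq: "q j = g (u + 2*pi*real j/3)" for j by (simp add: q_def x_eq u_def)
      consider "i = 0" | "i = 1" | "i = 2" using i by linarith
      then show ?thesis
      proof cases
        case 1 then show ?thesis by (simp add: q_eq loop_force_def per flip: u_def w_def)
      next
        case 2 then show ?thesis by (simp add: q_eq loop_force_def numeral_2_eq_2 add.commute[of "4 * pi / 3" u] flip: u_def w_def)
      next
        case 3 then show ?thesis
          by (simp add: q_eq loop_force_def s(3) add.commute[of "2 * pi" u] add.commute[of "2 * pi / 3" u] flip: u_def w_def)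
      qed
    qed
    then show "GDERIV (\<lambda>z. potential m \<alpha> ((\<lambda>j. x j (t / sqrt (1/m)))(i := z))) (x i (t / sqrt (1/m))) :>
        m *\<^sub>R (m *\<^sub>R loop_force \<alpha> g (t * sqrt m + 2*pi*real i/3))"
      using GDERIV_potential[OF i q, of m \<alpha>] unfolding q_def[abs_def] by (simp add: power2_eq_square)
  qed
  moreover have "0 < 1/m" using assms(3) by simp
  ultimately show ?thesis unfolding x_def using H by blast
qed

end
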